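(* Let $D\subseteq\mathbb{R}^{k}$ be a compact path-connected subspace, let $f_1,\ldots,f_n:D\to D$ be an iterated function system with attractor $F\subseteq D$, let $d=\dim_H(F)$ and let $\mu=H^{d}$ be $d$-dimensional Hausdorff measure, and assume $d>k-1$ and $0<\mu(F)<\infty$. Let $G$ be the group of isometries of $F$, let $X=\{f_1,\ldots,f_n\}$ and $I=\{1,\ldots,n\}$, and suppose further that: (i) for every $i,j\in I$ with $i\neq j$, $\mu(f_i(F)\cap f_j(F))=0$; (ii) there are no contractions $h$ of $F$ such that $f_i(F)\subset h(F)$ (proper inclusion) for some $i\in I$; (iii) for every $i\in I$ and $g\in G$ there exists $j\in I$ such that $g(f_i(F))=f_j(F)$. Then: 1. $\langle X\rangle$ is a free subsemigroup of $M(F)$ (so one writes $X^{*}=\langle X,1\rangle$). 2. Let $M:=\langle X,G\rangle\subseteq M(F)$. Then $M=X^{*}G$ uniquely, i.e. every element of $M$ is uniquely a product $xg$ with $x\in X^*$, $g\in G$. 3. $M$ is a Rees monoid. 4. If for every element $s\in M(F)$ there is an $f\in X^{*}$ with $s(F)=f(F)$, then $M=M(F)$ and $M$ is a fundamental Rees monoid.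
   Context: For a compact subset $D$ of $\mathbb{R}^k$, a similarity contraction of $D$ is a continuous injective map $f:D\to D$ for which there is a constant $0<c<1$ with $d(f(x),f(y))=c\,d(x,y)$ for all $x,y\in D$. $M(D)$ denotes the monoid, under composition $(ab)(x)=a(b(x))$, of all similarity contractions and isometries of $D$. "Contraction of $F$" in (ii) means a similarity contraction $F\to F$. An iterated function system is a finite family of similarity contractions $f_1,\dots,f_n:D\to D$; its attractor is the unique non-empty compact $F\subseteq D$ with $F=\bigcup_{i=1}^n f_i(F)$. The $f_i$ are regarded as elements of $M(F)$ by restriction to $F$. $\dim_H$ is Hausdorff dimension. A left Rees monoid is a monoid $M$, not a group, which is left cancellative, right rigid ($aM\cap bM\neq\emptyset$ implies $aM\subseteq bM$ or $bM\subseteq aM$) and in which each principal right ideal is properly contained in only finitely many principal right ideals; right Rees monoids are defined dually, and a Rees monoid is both left and right Rees. A left Rees monoid $M$ with group of units $G$ is fundamental if $\{g\in G: gs\in sG\text{ for all }s\in M\}=\{1\}$. *)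

theory Defs
  imports "HOL-Analysis.Analysis" "HOL-Algebra.Coset"
begin

text \<open>
  The value of \<open>diam(U)\<^sup>s\<close> with the usual conventions \<open>diam({})\<^sup>s = 0\<close> for all \<open>s\<close> and
  \<open>diam(U)\<^sup>0 = 1\<close> for nonempty \<open>U\<close>; they have to be spelt out because \<open>0 powr 0 = 0\<close>.
\<close>
definition diam_pow :: "real \<Rightarrow> 'a::metric_space set \<Rightarrow> ennreal" where
  "diam_pow s U = (if U = {} then 0 else if s = 0 then 1 else ennreal (diameter U powr s))"

text \<open>
  The covering sets are required to be bounded because \<^const>\<open>diameter\<close> is meaningless on
  unbounded sets. Finite covers are included, since a cover may be padded with empty sets.
\<close>
definition hausdorff_premeasure :: "real \<Rightarrow> real \<Rightarrow> 'a::metric_space set \<Rightarrow> ennreal" where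
  "hausdorff_premeasure s \<delta> S =
     (INF U \<in> {U :: nat \<Rightarrow> 'a set. S \<subseteq> (\<Union>i. U i) \<and> (\<forall>i. bounded (U i) \<and> diameter (U i) \<le> \<delta>)}.
        \<Sum>i. diam_pow s (U i))"

text \<open>
  The (unnormalised) \<open>s\<close>-dimensional Hausdorff measure, \<open>s \<ge> 0\<close>, as an outer measure on all
  subsets; on Borel sets it is a measure.
\<close>
definition hausdorff_measure :: "real \<Rightarrow> 'a::metric_space set \<Rightarrow> ennreal" where
  "hausdorff_measure s S = (SUP \<delta> \<in> {0<..}. hausdorff_premeasure s \<delta> S)"

definition hausdorff_dim :: "'a::metric_space set \<Rightarrow> ereal" where
  "hausdorff_dim S = Inf {ereal s | s. 0 \<le> s \<and> hausdorff_measure s S = 0}"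

definition sim_contraction :: "'a::metric_space set \<Rightarrow> ('a \<Rightarrow> 'a) \<Rightarrow> bool" where
  "sim_contraction D f \<longleftrightarrow> f \<in> D \<rightarrow> D \<and> continuous_on D f \<and> inj_on f D \<and>
     (\<exists>c. 0 < c \<and> c < 1 \<and> (\<forall>x\<in>D. \<forall>y\<in>D. dist (f x) (f y) = c * dist x y))"

definition self_isometry :: "'a::metric_space set \<Rightarrow> ('a \<Rightarrow> 'a) \<Rightarrow> bool" where
  "self_isometry D f \<longleftrightarrow> bij_betw f D D \<and> (\<forall>x\<in>D. \<forall>y\<in>D. dist (f x) (f y) = dist x y)"

text \<open>
  A self-map of \<open>D\<close> is represented by the function that is \<^const>\<open>undefined\<close> outside \<open>D\<close>, so that
  equality of elements is equality of maps on \<open>D\<close>.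
\<close>
definition isometries :: "'a::metric_space set \<Rightarrow> ('a \<Rightarrow> 'a) set" where
  "isometries D = {g \<in> extensional D. self_isometry D g}"

definition sim_monoid :: "'a::metric_space set \<Rightarrow> ('a \<Rightarrow> 'a) monoid" where
  "sim_monoid D =
     \<lparr>carrier = {f \<in> extensional D. sim_contraction D f \<or> self_isometry D f},
      mult = compose D,
      one = (\<lambda>x\<in>D. x)\<rparr>"

definition is_attractor ::
  "'a::metric_space set \<Rightarrow> 'i set \<Rightarrow> ('i \<Rightarrow> 'a \<Rightarrow> 'a) \<Rightarrow> 'a set \<Rightarrow> bool" where
  "is_attractor D I f F \<longleftrightarrow> F \<noteq> {} \<and> compact F \<and> F \<subseteq> D \<and> F = (\<Union>i\<in>I. f i ` F)"

inductive_set semigroup_span :: "('a, 'b) monoid_scheme \<Rightarrow> 'a set \<Rightarrow> 'a set"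
  for M (structure) and A where
  incl: "a \<in> A \<Longrightarrow> a \<in> semigroup_span M A"
| mult: "a \<in> semigroup_span M A \<Longrightarrow> b \<in> semigroup_span M A \<Longrightarrow> a \<otimes> b \<in> semigroup_span M A"

definition word_prod :: "('a, 'b) monoid_scheme \<Rightarrow> 'a list \<Rightarrow> 'a" where
  "word_prod M w = foldr (mult M) w \<one>\<^bsub>M\<^esub>"

text \<open>
  The subsemigroup generated by \<open>X\<close> is free on \<open>X\<close>: the canonical homomorphism from the
  free semigroup of nonempty words over \<open>X\<close> is a bijection onto it.
\<close>
definition generates_free_semigroup :: "('a, 'b) monoid_scheme \<Rightarrow> 'a set \<Rightarrow> bool" where
  "generates_free_semigroup M X \<longleftrightarrow> X \<subseteq> carrier M \<and>
     bij_betw (word_prod M) {w \<in> lists X. w \<noteq> []} (semigroup_span M X)"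

text \<open>The principal right ideal \<open>aM\<close> is the left coset \<open>a <#\<^bsub>M\<^esub> carrier M\<close>.\<close>

locale left_rees_monoid = monoid M for M (structure) +
  assumes not_group: "\<not> group M"
    and left_cancellative:
      "\<lbrakk>a \<in> carrier M; b \<in> carrier M; c \<in> carrier M; a \<otimes> b = a \<otimes> c\<rbrakk> \<Longrightarrow> b = c"
    and right_rigid:
      "\<lbrakk>a \<in> carrier M; b \<in> carrier M; (a <# carrier M) \<inter> (b <# carrier M) \<noteq> {}\<rbrakk>
        \<Longrightarrow> a <# carrier M \<subseteq> b <# carrier M \<or> b <# carrier M \<subseteq> a <# carrier M"
    and finite_above:
      "a \<in> carrier M \<Longrightarrow>
        finite {J. (\<exists>b\<in>carrier M. J = b <# carrier M) \<and> a <# carrier M \<subset> J}"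

definition opposite :: "('a, 'b) monoid_scheme \<Rightarrow> ('a, 'b) monoid_scheme" where
  "opposite M = M\<lparr>mult := (\<lambda>x y. y \<otimes>\<^bsub>M\<^esub> x)\<rparr>"

definition right_rees_monoid :: "('a, 'b) monoid_scheme \<Rightarrow> bool" where
  "right_rees_monoid M \<longleftrightarrow> left_rees_monoid (opposite M)"

definition rees_monoid :: "('a, 'b) monoid_scheme \<Rightarrow> bool" where
  "rees_monoid M \<longleftrightarrow> left_rees_monoid M \<and> right_rees_monoid M"

definition fundamental :: "('a, 'b) monoid_scheme \<Rightarrow> bool" where
  "fundamental M \<longleftrightarrow>
     {g \<in> Units M. \<forall>s\<in>carrier M. g \<otimes>\<^bsub>M\<^esub> s \<in> s <#\<^bsub>M\<^esub> Units M} = {\<one>\<^bsub>M\<^esub>}"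

end

theory Submission
  imports Defs
begin

text \<open>
  Write \<open>S\<close> for the monoid of similarity contractions and isometries of \<open>F\<close>. The proof separates
  what is geometric about \<open>F\<close> from what is then purely algebraic.

  Geometrically, four facts are needed. First, \<open>S\<close> is cancellative. Left cancellation is
  injectivity. For right cancellation, suppose that \<open>a\<close> and \<open>b\<close> agree on the image \<open>s(F)\<close> of some
  \<open>s \<in> S\<close>, but that \<open>a(x) \<noteq> b(x)\<close>. Every point of \<open>a(s(F))\<close> is equidistant from \<open>a(x)\<close> and \<open>b(x)\<close>,
  so this set lies in the bisecting hyperplane and has measure zero because \<open>d > k - 1\<close>; on the
  other hand a similar copy of \<open>F\<close> has positive measure. Second, the group of units of \<open>S\<close> is the
  group \<open>G\<close> of isometries of \<open>F\<close>, since ratios multiply and never exceed one. Third, for distinct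
  generators \<open>x\<close> and \<open>y\<close> one never has \<open>x a = y b\<close> in \<open>S\<close>: the image of \<open>x a\<close> has positive measure but would
  lie in the null set \<open>x(F) \<inter> y(F)\<close>. Fourth, \<open>g x \<in> y G\<close> for some generator \<open>y\<close> whenever \<open>g\<close> is an
  isometry and \<open>x\<close> a generator: if \<open>g(x(F)) = y(F)\<close>, then the inverse of \<open>y\<close> composed with \<open>g x\<close>
  is a similarity of the compact set \<open>F\<close> onto itself, so it has ratio one.

  Algebraically, the third fact and left cancellation show that two words \<open>u\<close> and \<open>v\<close> with
  \<open>u a = v b\<close> are comparable in the prefix order (\<open>word_prefix\<close>). Freeness and the unique
  factorisation \<open>M = X\<^sup>*G\<close> follow, because a nonempty word is never invertible. Since units move
  past generators, the length of the \<open>X\<close>-part of an element is a homomorphism from \<open>M\<close> to the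
  natural numbers, and prefix comparability becomes equidivisibility: if \<open>x a = y b\<close> and \<open>x\<close> is not
  longer than \<open>y\<close>, then \<open>y \<in> x M\<close>. The locale \<open>graded_rigid_monoid\<close> collects these properties.
  They imply the axioms of a left Rees monoid, and they are preserved when the multiplication is
  reversed, so \<open>M\<close> is also a right Rees monoid.

  Finally, if every image \<open>s(F)\<close> is already the image of a word \<open>w\<close>, then \<open>s \<in> w G\<close> by the argument
  of the fourth fact, so \<open>M = S\<close>. An isometry \<open>g\<close> with \<open>g s \<in> s G\<close> for all \<open>s\<close> preserves \<open>w(F)\<close> for
  every word \<open>w\<close>; each point of \<open>F\<close> lies in sets \<open>w(F)\<close> of arbitrarily small diameter, so \<open>g\<close> fixes
  it (\<open>fixes_pieces_imp_identity\<close>).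
\<close>

section \<open>Rees monoids from a length function\<close>

text \<open>
  Equidivisibility bounded by a length makes the Rees axioms self-dual: in the presence of
  cancellation, the locale is invariant under reversing the multiplication, whereas the axioms of
  a left Rees monoid are not.
\<close>
locale graded_rigid_monoid = monoid M for M (structure) +
  fixes len :: "'a \<Rightarrow> nat"
  assumes l_cancellative:
      "\<lbrakk>a \<in> carrier M; b \<in> carrier M; c \<in> carrier M; a \<otimes> b = a \<otimes> c\<rbrakk> \<Longrightarrow> b = c"
    and r_cancellative:
      "\<lbrakk>a \<in> carrier M; b \<in> carrier M; c \<in> carrier M; b \<otimes> a = c \<otimes> a\<rbrakk> \<Longrightarrow> b = c"
    and len_mult: "\<lbrakk>a \<in> carrier M; b \<in> carrier M\<rbrakk> \<Longrightarrow> len (a \<otimes> b) = len a + len b"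
    and len_nontrivial: "\<exists>a\<in>carrier M. 0 < len a"
    and equidivisible:
      "\<lbrakk>x \<in> carrier M; y \<in> carrier M; a \<in> carrier M; b \<in> carrier M;
        x \<otimes> a = y \<otimes> b; len x \<le> len y\<rbrakk> \<Longrightarrow> \<exists>t\<in>carrier M. y = x \<otimes> t"
begin

lemma r_ideal_antimono:
  assumes "x \<in> carrier M" "y \<in> carrier M" "(x <# carrier M) \<inter> (y <# carrier M) \<noteq> {}"
    and "len x \<le> len y"
  shows "y <# carrier M \<subseteq> x <# carrier M"
proof -
  obtain a b where ab: "a \<in> carrier M" "b \<in> carrier M" "x \<otimes> a = y \<otimes> b"
    using assms(3) by (auto simp: l_coset_def)
  then obtain t where "t \<in> carrier M" "y = x \<otimes> t"
    using equidivisible[OF assms(1,2) ab(1,2) ab(3) assms(4)] by blast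
  then show ?thesis
    using assms(1) by (auto simp: l_coset_def m_assoc)
qed

text \<open>
  By equidivisibility there is at most one principal right ideal above \<open>a\<close> that is generated by an
  element of a given length, and the lengths in question are bounded by that of \<open>a\<close>.
\<close>
lemma left_rees: "left_rees_monoid M"
proof
  show "\<not> group M"
  proof
    assume "group M"
    then interpret group M .
    obtain a where a: "a \<in> carrier M" "0 < len a"
      using len_nontrivial by blast
    have "len \<one> = 0"
      using len_mult[of \<one> \<one>] by simp
    moreover have "len (a \<otimes> inv a) = len a + len (inv a)"
      using a by (intro len_mult) auto
    ultimately show False
      using a by simp
  qed
next
  fix a b c
  show "\<lbrakk>a \<in> carrier M; b \<in> carrier M; c \<in> carrier M; a \<otimes> b = a \<otimes> c\<rbrakk> \<Longrightarrow> b = c"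
    by (rule l_cancellative)
next
  fix a b
  show "\<lbrakk>a \<in> carrier M; b \<in> carrier M; (a <# carrier M) \<inter> (b <# carrier M) \<noteq> {}\<rbrakk>
        \<Longrightarrow> a <# carrier M \<subseteq> b <# carrier M \<or> b <# carrier M \<subseteq> a <# carrier M"
    using r_ideal_antimono[of a b] r_ideal_antimono[of b a]
    by (metis Int_commute nle_le)
next
  fix a assume a: "a \<in> carrier M"
  let ?S = "{J. (\<exists>b\<in>carrier M. J = b <# carrier M) \<and> a <# carrier M \<subset> J}"
  \<comment> \<open>any choice of an element of length \<open>l\<close> that divides \<open>a\<close> on the left\<close>
  define gen where "gen l = (SOME b. b \<in> carrier M \<and> len b = l \<and> a \<in> b <# carrier M)" for l
  have "?S \<subseteq> (\<lambda>l. gen l <# carrier M) ` {..len a}"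
  proof
    fix J assume "J \<in> ?S"
    then obtain b where b: "b \<in> carrier M" "J = b <# carrier M" "a <# carrier M \<subset> J"
      by blast
    have "a \<in> a <# carrier M"
      using a r_one[OF a] by (auto simp: l_coset_def intro!: bexI[of _ \<one>])
    then have ab: "a \<in> b <# carrier M"
      using b by blast
    then have "len b \<le> len a"
      using b(1) len_mult by (auto simp: l_coset_def)
    moreover have "gen (len b) \<in> carrier M \<and> len (gen (len b)) = len b \<and> a \<in> gen (len b) <# carrier M"
      unfolding gen_def by (rule someI[of _ b]) (use b ab in simp)
    then have "J = gen (len b) <# carrier M"
      using r_ideal_antimono[of b "gen (len b)"] r_ideal_antimono[of "gen (len b)" b] b ab by auto
    ultimately show "J \<in> (\<lambda>l. gen l <# carrier M) ` {..len a}"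
      by blast
  qed
  then show "finite ?S"
    using finite_surj by blast
qed

section \<open>Free generators that are permuted by the units\<close>

text \<open>
  If \<open>a x = b y\<close> with \<open>y\<close> at least as long as \<open>x\<close>, then \<open>a\<close> is at least as long as \<open>b\<close>, so \<open>a = b t\<close>
  by equidivisibility, and cancelling \<open>b\<close> from \<open>b t x = b y\<close> gives \<open>t x = y\<close>: equidivisibility on
  the other side.
\<close>
lemma opposite_graded_rigid: "graded_rigid_monoid (opposite M) len"
proof (intro graded_rigid_monoid.intro graded_rigid_monoid_axioms.intro)
  show "monoid (opposite M)"
    by (rule monoidI) (auto simp: opposite_def m_assoc)
next
  fix a b c
  assume "a \<in> carrier (opposite M)" "b \<in> carrier (opposite M)" "c \<in> carrier (opposite M)"
    "a \<otimes>\<^bsub>opposite M\<^esub> b = a \<otimes>\<^bsub>opposite M\<^esub> c"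
  then show "b = c"
    using r_cancellative[of a b c] by (simp add: opposite_def)
next
  fix a b c
  assume "a \<in> carrier (opposite M)" "b \<in> carrier (opposite M)" "c \<in> carrier (opposite M)"
    "b \<otimes>\<^bsub>opposite M\<^esub> a = c \<otimes>\<^bsub>opposite M\<^esub> a"
  then show "b = c"
    using l_cancellative[of a b c] by (simp add: opposite_def)
next
  show "\<exists>a\<in>carrier (opposite M). 0 < len a"
    using len_nontrivial by (simp add: opposite_def)
next
  fix a b
  assume "a \<in> carrier (opposite M)" "b \<in> carrier (opposite M)"
  then show "len (a \<otimes>\<^bsub>opposite M\<^esub> b) = len a + len b"
    using len_mult[of b a] by (simp add: opposite_def)
next
  fix x y a b
  assume "x \<in> carrier (opposite M)" "y \<in> carrier (opposite M)"
    "a \<in> carrier (opposite M)" "b \<in> carrier (opposite M)"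
    "x \<otimes>\<^bsub>opposite M\<^esub> a = y \<otimes>\<^bsub>opposite M\<^esub> b" "len x \<le> len y"
  then have *: "x \<in> carrier M" "y \<in> carrier M" "a \<in> carrier M" "b \<in> carrier M"
    "a \<otimes> x = b \<otimes> y" "len x \<le> len y"
    by (auto simp: opposite_def)
  then have "len b \<le> len a"
    using len_mult[of a x] len_mult[of b y] by simp
  then obtain t where t: "t \<in> carrier M" "a = b \<otimes> t"
    using equidivisible[of b a y x] * by auto
  then have "t \<otimes> x = y"
    using l_cancellative[of b "t \<otimes> x" y] * by (simp add: m_assoc)
  then show "\<exists>t\<in>carrier (opposite M). y = x \<otimes>\<^bsub>opposite M\<^esub> t"
    using t by (auto simp: opposite_def)
qed

theorem rees: "rees_monoid M"
  unfolding rees_monoid_def right_rees_monoid_def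
  using left_rees graded_rigid_monoid.left_rees[OF opposite_graded_rigid] by blast

end

text \<open>
  The properties of the similarity monoid of \<open>F\<close> and of the iterated function system \<open>X\<close> on which
  the algebra rests. Independence says that distinct elements of \<open>X\<close> generate disjoint principal
  right ideals of the ambient monoid \<open>S\<close>; the last axiom lets units move to the right past
  generators.
\<close>
locale rigid_generators = monoid S for S (structure) +
  fixes X :: "'a set"
  assumes l_cancellative:
      "\<lbrakk>a \<in> carrier S; b \<in> carrier S; c \<in> carrier S; a \<otimes> b = a \<otimes> c\<rbrakk> \<Longrightarrow> b = c"
    and r_cancellative:
      "\<lbrakk>a \<in> carrier S; b \<in> carrier S; c \<in> carrier S; b \<otimes> a = c \<otimes> a\<rbrakk> \<Longrightarrow> b = c"
    and X_carrier: "X \<subseteq> carrier S"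
    and X_nonunit: "X \<inter> Units S = {}"
    and X_independent:
      "\<lbrakk>x \<in> X; y \<in> X; a \<in> carrier S; b \<in> carrier S; x \<otimes> a = y \<otimes> b\<rbrakk> \<Longrightarrow> x = y"
    and X_permuted: "\<lbrakk>g \<in> Units S; x \<in> X\<rbrakk> \<Longrightarrow> \<exists>y\<in>X. \<exists>h\<in>Units S. g \<otimes> x = y \<otimes> h"
begin

abbreviation word :: "'a list \<Rightarrow> 'a" where "word \<equiv> word_prod S"

lemma word_simps [simp]: "word [] = \<one>" "word (x # w) = x \<otimes> word w"
  by (simp_all add: word_prod_def)

lemma X_closed [simp]: "x \<in> X \<Longrightarrow> x \<in> carrier S"
  using X_carrier by blast

lemma word_closed [simp]: "set w \<subseteq> X \<Longrightarrow> word w \<in> carrier S"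
  by (induction w) auto

lemma Units_closed' [simp]: "g \<in> Units S \<Longrightarrow> g \<in> carrier S"
  by (rule Units_closed)

lemma word_append: "set u \<subseteq> X \<Longrightarrow> set v \<subseteq> X \<Longrightarrow> word (u @ v) = word u \<otimes> word v"
  by (induction u) (auto simp: m_assoc)

text \<open>
  In a cancellative monoid a right inverse is two-sided: from \<open>x t = 1\<close> follows \<open>x (t x) = x\<close>.
\<close>
lemma left_factor_of_unit:
  assumes "x \<in> carrier S" "s \<in> carrier S" "x \<otimes> s \<in> Units S"
  shows "x \<in> Units S"
proof -
  define t where "t = s \<otimes> inv (x \<otimes> s)"
  have t: "t \<in> carrier S"
    unfolding t_def using assms by simp
  have "x \<otimes> t = (x \<otimes> s) \<otimes> inv (x \<otimes> s)"
    unfolding t_def using assms(1,2) Units_inv_closed[OF assms(3)] by (simp only: m_assoc)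
  then have xt: "x \<otimes> t = \<one>"
    using assms by simp
  have "x \<otimes> (t \<otimes> x) = (x \<otimes> t) \<otimes> x"
    using assms(1) t by (simp only: m_assoc)
  then have "t \<otimes> x = \<one>"
    using l_cancellative[of x "t \<otimes> x" \<one>] assms t xt by simp
  then show ?thesis
    using t xt assms(1) \<open>t \<otimes> x = \<one>\<close> unfolding Units_def by blast
qed

lemma word_mult_unit_imp_Nil:
  assumes "set w \<subseteq> X" "s \<in> carrier S" "word w \<otimes> s \<in> Units S"
  shows "w = []"
proof (cases w)
  case (Cons x v)
  then have "x \<in> X" "set v \<subseteq> X" "x \<otimes> (word v \<otimes> s) \<in> Units S"
    using assms by (auto simp: m_assoc)
  then have "x \<in> Units S"
    using left_factor_of_unit[of x "word v \<otimes> s"] assms by simp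
  then show ?thesis
    using \<open>x \<in> X\<close> X_nonunit by blast
qed simp

text \<open>
  Comparing first letters, independence makes them equal and left cancellation removes them. The
  elements \<open>a\<close> and \<open>b\<close> are arbitrary, which covers freeness, unique factorisation and
  equidivisibility at once.
\<close>
lemma word_prefix:
  assumes "set u \<subseteq> X" "set v \<subseteq> X" "a \<in> carrier S" "b \<in> carrier S"
    and "word u \<otimes> a = word v \<otimes> b" "length u \<le> length v"
  shows "\<exists>w. set w \<subseteq> X \<and> v = u @ w"
  using assms
proof (induction u arbitrary: v)
  case Nil
  then show ?case by simp
next
  case (Cons x u)
  then obtain y v' where v: "v = y # v'"
    by (cases v) auto
  have mem: "x \<in> X" "y \<in> X" "set u \<subseteq> X" "set v' \<subseteq> X"
    using Cons.prems v by auto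
  have eq: "x \<otimes> (word u \<otimes> a) = y \<otimes> (word v' \<otimes> b)"
    using Cons.prems v mem by (simp add: m_assoc)
  then have "x = y"
    using X_independent[of x y "word u \<otimes> a" "word v' \<otimes> b"] mem Cons.prems by simp
  moreover have "word u \<otimes> a = word v' \<otimes> b"
    using eq \<open>x = y\<close> l_cancellative[of x "word u \<otimes> a" "word v' \<otimes> b"] mem Cons.prems by simp
  then have "\<exists>w. set w \<subseteq> X \<and> v' = u @ w"
    using Cons.IH[of v'] Cons.prems v mem by simp
  ultimately show ?case
    using v by simp
qed

text \<open>
  The shorter word is a prefix of the longer one. Cancelling it exhibits the remaining suffix as a
  left factor of a unit, so the suffix is empty.
\<close>
lemma word_unit_unique:
  assumes "set u \<subseteq> X" "set v \<subseteq> X" "g \<in> Units S" "h \<in> Units S"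
    and "word u \<otimes> g = word v \<otimes> h"
  shows "u = v \<and> g = h"
proof -
  have *: "v = u \<and> g = h" if uv: "set u \<subseteq> X" "set v \<subseteq> X" "g \<in> Units S" "h \<in> Units S"
    "word u \<otimes> g = word v \<otimes> h" "length u \<le> length v" for u v g h
  proof -
    obtain w where w: "set w \<subseteq> X" "v = u @ w"
      using word_prefix[of u v g h] uv by auto
    then have "word u \<otimes> g = word u \<otimes> (word w \<otimes> h)"
      using uv by (simp add: word_append m_assoc)
    then have g: "g = word w \<otimes> h"
      using l_cancellative[of "word u" g "word w \<otimes> h"] uv w by simp
    then have "w = []"
      using word_mult_unit_imp_Nil[of w h] w uv by simp
    then show ?thesis
      using g w uv by simp
  qed
  show ?thesis
    using *[of u v g h] *[of v u h g] assms by (metis nle_le)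
qed

lemma semigroup_span_X: "semigroup_span S X = word ` {w. set w \<subseteq> X \<and> w \<noteq> []}"
proof (intro subset_antisym subsetI)
  fix a assume "a \<in> semigroup_span S X"
  then show "a \<in> word ` {w. set w \<subseteq> X \<and> w \<noteq> []}"
  proof induction
    case (incl a)
    then show ?case by (intro image_eqI[of _ _ "[a]"]) auto
  next
    case (mult a b)
    then obtain u v where "set u \<subseteq> X" "u \<noteq> []" "set v \<subseteq> X" "a = word u" "b = word v"
      by blast
    then show ?case
      by (intro image_eqI[of _ _ "u @ v"]) (auto simp: word_append)
  qed
next
  fix a assume "a \<in> word ` {w. set w \<subseteq> X \<and> w \<noteq> []}"
  then obtain w where "set w \<subseteq> X" "w \<noteq> []" "a = word w" by blast
  moreover have "set w \<subseteq> X \<Longrightarrow> w \<noteq> [] \<Longrightarrow> word w \<in> semigroup_span S X" for w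
  proof (induction w)
    case (Cons x w)
    then show ?case
      by (cases "w = []") (auto intro: semigroup_span.intros)
  qed simp
  ultimately show "a \<in> semigroup_span S X" by blast
qed

lemma semigroup_span_X_one: "semigroup_span S (X \<union> {\<one>}) = word ` {w. set w \<subseteq> X}"
proof (intro subset_antisym subsetI)
  fix a assume "a \<in> semigroup_span S (X \<union> {\<one>})"
  then show "a \<in> word ` {w. set w \<subseteq> X}"
  proof induction
    case (incl a)
    then show ?case
      by (intro image_eqI[of _ _ "if a = \<one> then [] else [a]"]) auto
  next
    case (mult a b)
    then obtain u v where "set u \<subseteq> X" "set v \<subseteq> X" "a = word u" "b = word v"
      by blast
    then show ?case
      by (intro image_eqI[of _ _ "u @ v"]) (auto simp: word_append)
  qed
next
  fix a assume "a \<in> word ` {w. set w \<subseteq> X}"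
  then obtain w where "set w \<subseteq> X" "a = word w" by blast
  moreover have "set w \<subseteq> X \<Longrightarrow> word w \<in> semigroup_span S (X \<union> {\<one>})" for w
    by (induction w) (auto intro: semigroup_span.intros)
  ultimately show "a \<in> semigroup_span S (X \<union> {\<one>})" by blast
qed

theorem free: "generates_free_semigroup S X"
proof -
  have "inj_on word {w. set w \<subseteq> X \<and> w \<noteq> []}"
  proof (rule inj_onI)
    fix u v
    assume "u \<in> {w. set w \<subseteq> X \<and> w \<noteq> []}" "v \<in> {w. set w \<subseteq> X \<and> w \<noteq> []}" "word u = word v"
    then show "u = v"
      using word_unit_unique[of u v \<one> \<one>] by simp
  qed
  then show ?thesis
    unfolding generates_free_semigroup_def bij_betw_def lists_eq_set
    using semigroup_span_X X_carrier by simp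
qed

lemma unit_past_word:
  assumes "g \<in> Units S" "set w \<subseteq> X"
  shows "\<exists>w' h. set w' \<subseteq> X \<and> length w' = length w \<and> h \<in> Units S \<and> g \<otimes> word w = word w' \<otimes> h"
  using assms
proof (induction w arbitrary: g)
  case Nil
  then show ?case by (intro exI[of _ "[]"] exI[of _ g]) simp
next
  case (Cons x w)
  then have x: "x \<in> X" "set w \<subseteq> X"
    by auto
  obtain y h where y: "y \<in> X" "h \<in> Units S" "g \<otimes> x = y \<otimes> h"
    using X_permuted[OF Cons.prems(1) x(1)] by blast
  obtain w' h' where w': "set w' \<subseteq> X" "length w' = length w" "h' \<in> Units S"
    "h \<otimes> word w = word w' \<otimes> h'"
    using Cons.IH[OF y(2) x(2)] by blast
  have "g \<otimes> word (x # w) = (g \<otimes> x) \<otimes> word w"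
    using Cons.prems x by (simp add: m_assoc)
  also have "\<dots> = y \<otimes> (h \<otimes> word w)"
    using y x by (simp add: m_assoc)
  also have "\<dots> = word (y # w') \<otimes> h'"
    using w' y by (simp add: m_assoc)
  finally show ?case
    using y w' by (intro exI[of _ "y # w'"] exI[of _ h']) simp
qed

text \<open>
  The product set \<open>X\<^sup>*G\<close>, where \<open>G\<close> is the group of units. It turns out to be the submonoid
  generated by \<open>X\<close> and \<open>G\<close> (\<open>semigroup_span_X_Units\<close>).
\<close>
definition generated :: "'a set" where
  "generated = {word w \<otimes> g | w g. set w \<subseteq> X \<and> g \<in> Units S}"

lemma generatedI: "set w \<subseteq> X \<Longrightarrow> g \<in> Units S \<Longrightarrow> word w \<otimes> g \<in> generated"
  unfolding generated_def by blast

lemma generatedE: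
  assumes "a \<in> generated"
  obtains w g where "set w \<subseteq> X" "g \<in> Units S" "a = word w \<otimes> g"
  using assms unfolding generated_def by blast

lemma generated_carrier: "generated \<subseteq> carrier S"
  by (auto elim!: generatedE)

lemma Units_subset_generated: "Units S \<subseteq> generated"
  using generatedI[of "[]"] by auto

lemma word_unit_mult:
  assumes "set u \<subseteq> X" "g \<in> Units S" "set v \<subseteq> X" "h \<in> Units S"
  shows "\<exists>w k. set w \<subseteq> X \<and> k \<in> Units S \<and> length w = length u + length v \<and>
    (word u \<otimes> g) \<otimes> (word v \<otimes> h) = word w \<otimes> k"
proof -
  obtain v' g' where v': "set v' \<subseteq> X" "length v' = length v" "g' \<in> Units S"
    "g \<otimes> word v = word v' \<otimes> g'"
    using unit_past_word[OF assms(2,3)] by blast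
  have "(word u \<otimes> g) \<otimes> (word v \<otimes> h) = word u \<otimes> (g \<otimes> word v) \<otimes> h"
    using assms by (simp add: m_assoc)
  also have "\<dots> = word (u @ v') \<otimes> (g' \<otimes> h)"
    using assms v' by (simp add: m_assoc word_append)
  finally show ?thesis
    using assms v' by (intro exI[of _ "u @ v'"] exI[of _ "g' \<otimes> h"]) simp
qed

lemma generated_mult:
  assumes "a \<in> generated" "b \<in> generated"
  shows "a \<otimes> b \<in> generated"
proof -
  obtain u g v h where "set u \<subseteq> X" "g \<in> Units S" "set v \<subseteq> X" "h \<in> Units S"
    "a = word u \<otimes> g" "b = word v \<otimes> h"
    using assms by (elim generatedE)
  then show ?thesis
    using word_unit_mult[of u g v h] generatedI by auto
qed

lemma semigroup_span_X_Units: "semigroup_span S (X \<union> Units S) = generated"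
proof (intro subset_antisym subsetI)
  fix a assume "a \<in> semigroup_span S (X \<union> Units S)"
  then show "a \<in> generated"
  proof induction
    case (incl a)
    then show ?case
      using Units_subset_generated generatedI[of "[a]" \<one>] by auto
  qed (rule generated_mult)
next
  fix a assume "a \<in> generated"
  then obtain w g where "set w \<subseteq> X" "g \<in> Units S" "a = word w \<otimes> g"
    by (rule generatedE)
  moreover have "set w \<subseteq> X \<Longrightarrow> g \<in> Units S \<Longrightarrow> word w \<otimes> g \<in> semigroup_span S (X \<union> Units S)" for w g
    by (induction w) (auto intro: semigroup_span.intros simp: m_assoc)
  ultimately show "a \<in> semigroup_span S (X \<union> Units S)"
    by blast
qed

text \<open>
  The length of the word in the unique factorisation of an element of \<open>X\<^sup>*G\<close>; unspecified
  elsewhere.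
\<close>
definition word_length :: "'a \<Rightarrow> nat" where
  "word_length a = (THE n. \<exists>w g. set w \<subseteq> X \<and> g \<in> Units S \<and> a = word w \<otimes> g \<and> n = length w)"

lemma word_length_eq:
  assumes "set w \<subseteq> X" "g \<in> Units S"
  shows "word_length (word w \<otimes> g) = length w"
  unfolding word_length_def
  by (rule the_equality) (use assms word_unit_unique in blast)+

text \<open>
  Moving a unit past a word keeps the length of the word, so \<open>word_length\<close> is additive. If
  \<open>u g a = v h b\<close> with \<open>u\<close> not longer than \<open>v\<close>, then \<open>v = u w\<close>, and the quotient of \<open>v h\<close> by \<open>u g\<close> is
  the inverse of \<open>g\<close> times \<open>w h\<close>.
\<close>
theorem generated_graded_rigid:
  assumes "X \<noteq> {}"
  shows "graded_rigid_monoid (S\<lparr>carrier := generated\<rparr>) word_length"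
    (is "graded_rigid_monoid ?M _")
proof -
  have one: "\<one> \<in> generated" using Units_subset_generated by auto
  have mon: "monoid ?M"
    by (rule monoidI) (simp_all add: one generated_mult m_assoc subsetD[OF generated_carrier])
  show ?thesis
  proof (rule graded_rigid_monoid.intro[OF mon], rule graded_rigid_monoid_axioms.intro)
    fix a b c
    assume "a \<in> carrier ?M" "b \<in> carrier ?M" "c \<in> carrier ?M"
    then have abc: "a \<in> carrier S" "b \<in> carrier S" "c \<in> carrier S"
      using generated_carrier by auto
    show "b = c" if "a \<otimes>\<^bsub>?M\<^esub> b = a \<otimes>\<^bsub>?M\<^esub> c"
      using l_cancellative[of a b c] abc that by simp
    show "b = c" if "b \<otimes>\<^bsub>?M\<^esub> a = c \<otimes>\<^bsub>?M\<^esub> a"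
      using r_cancellative[of a b c] abc that by simp
  next
    fix a b
    assume "a \<in> carrier ?M" "b \<in> carrier ?M"
    then obtain u v g h where *: "set u \<subseteq> X" "set v \<subseteq> X" "g \<in> Units S" "h \<in> Units S"
      "a = word u \<otimes> g" "b = word v \<otimes> h"
      by (auto elim!: generatedE)
    then obtain w k where "set w \<subseteq> X" "k \<in> Units S" "length w = length u + length v"
      "(word u \<otimes> g) \<otimes> (word v \<otimes> h) = word w \<otimes> k"
      using word_unit_mult[of u g v h] by blast
    then show "word_length (a \<otimes>\<^bsub>?M\<^esub> b) = word_length a + word_length b"
      using * by (simp add: word_length_eq)
  next
    obtain x where x: "x \<in> X" using assms by blast
    then show "\<exists>a\<in>carrier ?M. 0 < word_length a"
      using generatedI[of "[x]" \<one>] word_length_eq[of "[x]" \<one>]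
      by (intro bexI[of _ "word [x] \<otimes> \<one>"]) auto
  next
    fix x y a b
    assume "x \<in> carrier ?M" "y \<in> carrier ?M" "a \<in> carrier ?M" "b \<in> carrier ?M"
      and eq: "x \<otimes>\<^bsub>?M\<^esub> a = y \<otimes>\<^bsub>?M\<^esub> b"
      and len: "word_length x \<le> word_length y"
    then obtain u v g h where *: "set u \<subseteq> X" "set v \<subseteq> X" "g \<in> Units S" "h \<in> Units S"
      "x = word u \<otimes> g" "y = word v \<otimes> h" and ab: "a \<in> carrier S" "b \<in> carrier S"
      using generated_carrier by (auto elim!: generatedE)
    then have "word u \<otimes> (g \<otimes> a) = word v \<otimes> (h \<otimes> b)"
      using eq by (simp add: m_assoc)
    moreover have "length u \<le> length v"
      using len * by (simp add: word_length_eq)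
    ultimately obtain w where w: "set w \<subseteq> X" "v = u @ w"
      using word_prefix[of u v "g \<otimes> a" "h \<otimes> b"] *(1-4) ab by auto
    define t where "t = inv g \<otimes> (word w \<otimes> h)"
    have "t \<in> generated"
      unfolding t_def using * w Units_subset_generated by (intro generated_mult generatedI) auto
    moreover have "x \<otimes> t = word u \<otimes> ((g \<otimes> inv g) \<otimes> (word w \<otimes> h))"
      unfolding t_def using * w by (simp add: m_assoc del: Units_r_inv)
    then have "y = x \<otimes> t"
      using * w by (simp add: m_assoc word_append)
    ultimately show "\<exists>t\<in>carrier ?M. y = x \<otimes>\<^bsub>?M\<^esub> t"
      by auto
  qed
qed

lemma generated_factorisation:
  "generated = semigroup_span S (X \<union> {\<one>}) <#> Units S"
  "\<forall>m\<in>generated. \<exists>!(x, g). x \<in> semigroup_span S (X \<union> {\<one>}) \<and> g \<in> Units S \<and> m = x \<otimes> g"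
proof -
  show "generated = semigroup_span S (X \<union> {\<one>}) <#> Units S"
    unfolding semigroup_span_X_one set_mult_def generated_def by blast
  show "\<forall>m\<in>generated. \<exists>!(x, g). x \<in> semigroup_span S (X \<union> {\<one>}) \<and> g \<in> Units S \<and> m = x \<otimes> g"
    unfolding semigroup_span_X_one
  proof
    fix m assume "m \<in> generated"
    then obtain w g where w: "set w \<subseteq> X" "g \<in> Units S" "m = word w \<otimes> g"
      by (rule generatedE)
    show "\<exists>!(x, g). x \<in> word ` {w. set w \<subseteq> X} \<and> g \<in> Units S \<and> m = x \<otimes> g"
    proof (rule ex1I[of _ "(word w, g)"])
      show "case (word w, g) of (x, g) \<Rightarrow> x \<in> word ` {w. set w \<subseteq> X} \<and> g \<in> Units S \<and> m = x \<otimes> g"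
        using w by blast
    next
      fix p
      assume "case p of (x, g) \<Rightarrow> x \<in> word ` {w. set w \<subseteq> X} \<and> g \<in> Units S \<and> m = x \<otimes> g"
      then obtain v h where "set v \<subseteq> X" "h \<in> Units S" "m = word v \<otimes> h" "p = (word v, h)"
        by blast
      then show "p = (word w, g)"
        using w word_unit_unique[of w v g h] by simp
    qed
  qed
qed

end

section \<open>Hausdorff measure, Lipschitz maps and hyperplanes\<close>

lemma hausdorff_measure_mono:
  assumes "S \<subseteq> T"
  shows "hausdorff_measure s S \<le> hausdorff_measure s T"
  unfolding hausdorff_measure_def hausdorff_premeasure_def
  by (intro SUP_subset_mono INF_superset_mono) (use assms in auto)

lemma diameter_lipschitz_image:
  fixes g :: "'a::metric_space \<Rightarrow> 'b::metric_space"
  assumes "bounded U" "0 \<le> L"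
    and lip: "\<And>x y. x \<in> U \<Longrightarrow> y \<in> U \<Longrightarrow> dist (g x) (g y) \<le> L * dist x y"
  shows "bounded (g ` U)" "diameter (g ` U) \<le> L * diameter U"
proof -
  have *: "dist (g x) (g y) \<le> L * diameter U" if "x \<in> U" "y \<in> U" for x y
    using lip[OF that] diameter_bounded_bound[OF \<open>bounded U\<close> that]
      mult_left_mono[OF _ \<open>0 \<le> L\<close>, of "dist x y" "diameter U"] by linarith
  then show "bounded (g ` U)"
    unfolding bounded_two_points by blast
  show "diameter (g ` U) \<le> L * diameter U"
  proof (cases "U = {}")
    case False
    then show ?thesis
      unfolding diameter_def[of "g ` U"] using * by (auto intro!: cSUP_least)
  qed simp
qed

lemma diam_pow_lipschitz_image:
  fixes g :: "'a::metric_space \<Rightarrow> 'b::metric_space"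
  assumes "0 < s" "bounded U" "0 \<le> L"
    and "\<And>x y. x \<in> U \<Longrightarrow> y \<in> U \<Longrightarrow> dist (g x) (g y) \<le> L * dist x y"
  shows "diam_pow s (g ` U) \<le> ennreal (L powr s) * diam_pow s U"
proof -
  have "diameter (g ` U) powr s \<le> (L * diameter U) powr s"
    using assms diameter_lipschitz_image[of U L g] by (intro powr_mono2 diameter_ge_0) auto
  also have "\<dots> = L powr s * diameter U powr s"
    by (rule powr_mult)
  finally show ?thesis
    using assms by (auto simp: diam_pow_def ennreal_leI simp flip: ennreal_mult)
qed

lemma diam_pow_mono:
  assumes "0 \<le> s" "U \<subseteq> V" "bounded V"
  shows "diam_pow s U \<le> diam_pow s V"
proof (cases "U = {}")
  case False
  then show ?thesis
    using assms diameter_subset[of U V] diameter_ge_0[of U] bounded_subset[of V U]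
    by (auto simp: diam_pow_def intro!: ennreal_leI powr_mono2)
qed (simp add: diam_pow_def)

text \<open>
  A cover of \<open>A\<close> is first cut down to subsets of \<open>A\<close>, where \<open>g\<close> is Lipschitz, and then mapped
  forward. The factor is moved to the other side as its inverse, so that the infimum over the
  covers of \<open>A\<close> can be taken.
\<close>
lemma hausdorff_premeasure_lipschitz_image:
  fixes g :: "'a::metric_space \<Rightarrow> 'b::metric_space"
  assumes s: "0 < s" and L: "0 < L"
    and lip: "\<And>x y. x \<in> A \<Longrightarrow> y \<in> A \<Longrightarrow> dist (g x) (g y) \<le> L * dist x y"
  shows "hausdorff_premeasure s (L * \<delta>) (g ` A) \<le> ennreal (L powr s) * hausdorff_premeasure s \<delta> A"
proof -
  let ?c = "ennreal (L powr s)" and ?c' = "ennreal (L powr (- s))"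
  let ?P = "hausdorff_premeasure s (L * \<delta>) (g ` A)"
  have cc: "?c * ?c' = 1"
    using L by (simp flip: ennreal_mult powr_add)
  have "?c' * ?P \<le> hausdorff_premeasure s \<delta> A"
    unfolding hausdorff_premeasure_def[of s \<delta>]
  proof (rule INF_greatest)
    fix U :: "nat \<Rightarrow> 'a set"
    assume U: "U \<in> {U. A \<subseteq> (\<Union>i. U i) \<and> (\<forall>i. bounded (U i) \<and> diameter (U i) \<le> \<delta>)}"
    define V where "V i = U i \<inter> A" for i
    have Ui: "bounded (U i)" "diameter (U i) \<le> \<delta>" "V i \<subseteq> U i" for i
      using U by (auto simp: V_def)
    have V: "bounded (V i)" "diameter (V i) \<le> \<delta>" for i
      using bounded_subset[OF Ui(1,3)[of i]] diameter_subset[OF Ui(3,1)[of i]] Ui(2)[of i]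
      by linarith+
    have lipV: "dist (g x) (g y) \<le> L * dist x y" if "x \<in> V i" "y \<in> V i" for x y i
      using that by (intro lip) (auto simp: V_def)
    have gV: "bounded (g ` V i)" "diameter (g ` V i) \<le> L * \<delta>" for i
      using diameter_lipschitz_image[OF V(1)[of i] less_imp_le[OF L], of g, OF lipV[where i = i]]
        mult_left_mono[OF V(2)[of i] less_imp_le[OF L]] by linarith+
    have "g ` A \<subseteq> (\<Union>i. g ` V i)"
      using U by (fastforce simp: V_def)
    then have "?P \<le> (\<Sum>i. diam_pow s (g ` V i))"
      unfolding hausdorff_premeasure_def using gV by (intro INF_lower) auto
    also have "\<dots> \<le> (\<Sum>i. ?c * diam_pow s (U i))"
    proof (rule suminf_le)
      fix i
      have "diam_pow s (g ` V i) \<le> ?c * diam_pow s (V i)"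
        by (rule diam_pow_lipschitz_image[OF s V(1)[of i] less_imp_le[OF L], of g, OF lipV[where i = i]])
      also have "\<dots> \<le> ?c * diam_pow s (U i)"
        using Ui s by (intro mult_left_mono diam_pow_mono) auto
      finally show "diam_pow s (g ` V i) \<le> ?c * diam_pow s (U i)" .
    qed auto
    also have "\<dots> = ?c * (\<Sum>i. diam_pow s (U i))"
      by simp
    finally have "?c' * ?P \<le> ?c' * (?c * (\<Sum>i. diam_pow s (U i)))"
      by (intro mult_left_mono) auto
    also have "\<dots> = (?c * ?c') * (\<Sum>i. diam_pow s (U i))"
      by (simp only: mult_ac)
    finally show "?c' * ?P \<le> (\<Sum>i. diam_pow s (U i))"
      by (simp only: cc mult_1)
  qed
  then have "?c * (?c' * ?P) \<le> ?c * hausdorff_premeasure s \<delta> A"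
    by (intro mult_left_mono) auto
  then show ?thesis
    by (simp only: mult.assoc[symmetric] cc mult_1)
qed

lemma hausdorff_measure_lipschitz_image:
  fixes g :: "'a::metric_space \<Rightarrow> 'b::metric_space"
  assumes s: "0 < s" and L: "0 < L"
    and lip: "\<And>x y. x \<in> A \<Longrightarrow> y \<in> A \<Longrightarrow> dist (g x) (g y) \<le> L * dist x y"
  shows "hausdorff_measure s (g ` A) \<le> ennreal (L powr s) * hausdorff_measure s A"
  unfolding hausdorff_measure_def[of s "g ` A"]
proof (rule SUP_least)
  fix \<delta> :: real assume \<delta>: "\<delta> \<in> {0<..}"
  have "hausdorff_premeasure s (L * (\<delta> / L)) (g ` A) \<le> ennreal (L powr s) * hausdorff_premeasure s (\<delta> / L) A"
    by (rule hausdorff_premeasure_lipschitz_image[OF s L lip])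
  also have "\<dots> \<le> ennreal (L powr s) * hausdorff_measure s A"
    unfolding hausdorff_measure_def using \<delta> L by (intro mult_left_mono SUP_upper) auto
  finally show "hausdorff_premeasure s \<delta> (g ` A) \<le> ennreal (L powr s) * hausdorff_measure s A"
    using L by simp
qed

lemma hausdorff_premeasure_finite_cover:
  fixes S :: "'a::metric_space set"
  assumes "finite C" "S \<subseteq> \<Union>C" "0 < s" "r \<le> \<delta>" "0 \<le> r"
    and C: "\<And>U. U \<in> C \<Longrightarrow> bounded U \<and> diameter U \<le> r"
  shows "hausdorff_premeasure s \<delta> S \<le> of_nat (card C) * ennreal (r powr s)"
proof -
  obtain b where b: "bij_betw b {0..<card C} C"
    using ex_bij_betw_nat_finite[OF \<open>finite C\<close>] by blast
  define U where "U i = (if i < card C then b i else {})" for i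
  have bC: "b i \<in> C" if "i < card C" for i
    using b that by (auto simp: bij_betw_def)
  have "S \<subseteq> (\<Union>i. U i)"
  proof
    fix x assume "x \<in> S"
    then obtain V where "V \<in> C" "x \<in> V" using assms by blast
    then have "V \<in> b ` {0..<card C}"
      using bij_betw_imp_surj_on[OF b] by simp
    then obtain i where "i < card C" "V = b i"
      by auto
    then show "x \<in> (\<Union>i. U i)"
      using \<open>x \<in> V\<close> by (intro UN_I[of i]) (simp_all add: U_def)
  qed
  moreover have "bounded (U i) \<and> diameter (U i) \<le> \<delta>" for i
    using C[OF bC[of i]] assms(4,5) by (cases "i < card C") (simp_all add: U_def)
  ultimately have "hausdorff_premeasure s \<delta> S \<le> (\<Sum>i. diam_pow s (U i))"
    unfolding hausdorff_premeasure_def by (intro INF_lower) auto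
  also have "\<dots> = (\<Sum>i<card C. diam_pow s (U i))"
    by (rule suminf_finite) (auto simp: U_def diam_pow_def)
  also have "\<dots> \<le> of_nat (card {..<card C}) * ennreal (r powr s)"
  proof (rule sum_bounded_above)
    fix i assume "i \<in> {..<card C}"
    then have "bounded (U i)" "diameter (U i) \<le> r"
      using C[OF bC[of i]] by (simp_all add: U_def)
    then have "diameter (U i) powr s \<le> r powr s"
      using \<open>0 < s\<close> by (simp add: powr_mono2 diameter_ge_0)
    then show "diam_pow s (U i) \<le> ennreal (r powr s)"
      using \<open>0 < s\<close> by (simp add: diam_pow_def ennreal_leI)
  qed
  finally show ?thesis by simp
qed

text \<open>
  A hyperplane that is not parallel to the \<open>j\<close>-th axis is a Lipschitz graph over the remaining
  coordinates.
\<close>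
lemma hyperplane_dist_le:
  fixes v x y :: "real^'k"
  assumes "v $ j \<noteq> 0" "v \<bullet> x = v \<bullet> y" "\<And>i. i \<noteq> j \<Longrightarrow> \<bar>x $ i - y $ i\<bar> \<le> e"
  shows "dist x y \<le> (\<Sum>i\<in>-{j}. 1 + \<bar>v $ i / v $ j\<bar>) * e"
proof -
  have U: "UNIV = insert j (-{j})" by auto
  have "0 = v \<bullet> (x - y)"
    using assms(2) by (simp add: inner_diff_right)
  also have "\<dots> = (\<Sum>i\<in>insert j (-{j}). v $ i * (x $ i - y $ i))"
    unfolding U[symmetric] by (simp add: inner_vec_def)
  also have "\<dots> = v $ j * (x $ j - y $ j) + (\<Sum>i\<in>-{j}. v $ i * (x $ i - y $ i))"
    by simp
  finally have "x $ j - y $ j = - (\<Sum>i\<in>-{j}. v $ i / v $ j * (x $ i - y $ i))"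
    using assms(1) by (simp add: eq_neg_iff_add_eq_0 flip: sum_divide_distrib) (simp add: field_simps)
  then have "\<bar>x $ j - y $ j\<bar> \<le> (\<Sum>i\<in>-{j}. \<bar>v $ i / v $ j * (x $ i - y $ i)\<bar>)"
    by (simp only: abs_minus_cancel sum_abs)
  also have "\<dots> \<le> (\<Sum>i\<in>-{j}. \<bar>v $ i / v $ j\<bar> * e)"
    unfolding abs_mult using assms(3) by (intro sum_mono mult_left_mono) auto
  finally have j: "\<bar>x $ j - y $ j\<bar> \<le> (\<Sum>i\<in>-{j}. \<bar>v $ i / v $ j\<bar> * e)" .
  have "dist x y \<le> (\<Sum>i\<in>insert j (-{j}). \<bar>x $ i - y $ i\<bar>)"
    unfolding U[symmetric] dist_norm using norm_le_l1_cart[of "x - y"] by simp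
  also have "\<dots> = \<bar>x $ j - y $ j\<bar> + (\<Sum>i\<in>-{j}. \<bar>x $ i - y $ i\<bar>)"
    by simp
  also have "\<dots> \<le> (\<Sum>i\<in>-{j}. \<bar>v $ i / v $ j\<bar> * e) + (\<Sum>i\<in>-{j}. e)"
    by (rule add_mono[OF j sum_mono]) (use assms(3) in simp)
  also have "\<dots> = (\<Sum>i\<in>-{j}. 1 + \<bar>v $ i / v $ j\<bar>) * e"
    by (simp only: sum_distrib_right flip: sum.distrib) (simp add: algebra_simps)
  finally show ?thesis .
qed

lemma abs_diff_lt_1_if_nat_floor_eq:
  fixes a b :: real
  assumes "0 \<le> a" "0 \<le> b" "nat \<lfloor>a\<rfloor> = nat \<lfloor>b\<rfloor>"
  shows "\<bar>a - b\<bar> < 1"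
proof -
  have "\<lfloor>a\<rfloor> = \<lfloor>b\<rfloor>"
    using assms by (simp add: nat_eq_iff split: if_splits)
  then show ?thesis by linarith
qed

text \<open>
  Only the \<open>k - 1\<close> coordinates other than the \<open>j\<close>-th are subdivided, each into \<open>m\<close> intervals of
  length \<open>2 B / m\<close>. This is where the exponent \<open>k - 1\<close> comes from.
\<close>
lemma hyperplane_grid_cover:
  fixes F :: "(real^'k) set"
  assumes v: "v $ j \<noteq> 0" and F: "\<And>x. x \<in> F \<Longrightarrow> v \<bullet> x = \<beta>"
    and B: "\<And>x i. x \<in> F \<Longrightarrow> \<bar>x $ i\<bar> < B" "0 < B" and m: "0 < m"
  shows "\<exists>C. finite C \<and> card C \<le> m ^ (CARD('k) - 1) \<and> F \<subseteq> \<Union>C \<and>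
    (\<forall>U\<in>C. bounded U \<and> diameter U \<le> (\<Sum>i\<in>-{j}. 1 + \<bar>v $ i / v $ j\<bar>) * (2 * B / real m))"
    (is "\<exists>C. _ \<and> _ \<and> _ \<and> (\<forall>U\<in>C. _ \<and> _ \<le> ?r)")
proof -
  \<comment> \<open>\<open>a x i\<close> is the \<open>i\<close>-th coordinate rescaled from \<open>(-B, B)\<close> to \<open>(0, m)\<close>; its integer part is the
    index of the interval that contains it\<close>
  define a where "a x i = (x $ i + B) * real m / (2 * B)" for x :: "real^'k" and i
  define q where "q x = (\<lambda>i\<in>-{j}. nat \<lfloor>a x i\<rfloor>)" for x
  define P where "P = (PiE (-{j}) (\<lambda>_. {..<m}) :: ('k \<Rightarrow> nat) set)"
  define C where "C = (\<lambda>p. {x \<in> F. q x = p}) ` P"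
  have a_nonneg: "0 \<le> a x i" and a_less: "a x i < real m" if "x \<in> F" for x i
  proof -
    have "\<bar>x $ i\<bar> < B" by (rule B(1)[OF that])
    then show "0 \<le> a x i"
      unfolding a_def using B(2) by simp
    have "(x $ i + B) * real m < (2 * B) * real m"
      using \<open>\<bar>x $ i\<bar> < B\<close> m by (intro mult_strict_right_mono) auto
    then show "a x i < real m"
      unfolding a_def using B(2) by (simp add: divide_less_eq mult.commute)
  qed
  have finP: "finite P"
    unfolding P_def by (intro finite_PiE) auto
  have "card P = m ^ card (-{j})"
    unfolding P_def by (simp add: card_PiE)
  also have "card (-{j} :: 'k set) = CARD('k) - 1"
    by (simp add: card_Diff_singleton Compl_eq_Diff_UNIV)
  finally have cardP: "card P = m ^ (CARD('k) - 1)" .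
  have "q x \<in> P" if "x \<in> F" for x
  proof -
    have "nat \<lfloor>a x i\<rfloor> < m" for i
      using a_nonneg[OF that, of i] a_less[OF that, of i] by linarith
    then show ?thesis
      unfolding P_def q_def by auto
  qed
  then have "F \<subseteq> \<Union>C"
    unfolding C_def by blast
  moreover have "bounded U \<and> diameter U \<le> ?r" if U: "U \<in> C" for U
  proof -
    obtain p where p: "U = {x \<in> F. q x = p}"
      using U unfolding C_def by blast
    have dU: "dist x y \<le> ?r" if xy: "x \<in> U" "y \<in> U" for x y
    proof (rule hyperplane_dist_le[OF v])
      show "v \<bullet> x = v \<bullet> y"
        using F xy p by simp
      fix i assume "i \<noteq> j"
      have xyF: "x \<in> F" "y \<in> F" "q x i = q y i"
        using xy p by auto
      then have "nat \<lfloor>a x i\<rfloor> = nat \<lfloor>a y i\<rfloor>"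
        using \<open>i \<noteq> j\<close> by (simp add: q_def)
      then have "\<bar>a x i - a y i\<bar> < 1"
        using a_nonneg xyF by (intro abs_diff_lt_1_if_nat_floor_eq) auto
      then have "\<bar>(a x i - a y i) * (2 * B / real m)\<bar> \<le> 1 * (2 * B / real m)"
        unfolding abs_mult using B(2) by (intro mult_mono) auto
      moreover have "(a x i - a y i) * (2 * B / real m) = x $ i - y $ i"
        unfolding a_def using m B(2) by (simp add: field_simps)
      ultimately show "\<bar>x $ i - y $ i\<bar> \<le> 2 * B / real m"
        by (simp only: mult_1)
    qed
    moreover have "0 \<le> ?r"
      using B(2) by (intro mult_nonneg_nonneg sum_nonneg) auto
    ultimately have "diameter U \<le> ?r"
      by (intro diameter_le) (auto simp: dist_norm)
    then show ?thesis
      using dU unfolding bounded_two_points by blast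
  qed
  moreover have "finite C" "card C \<le> m ^ (CARD('k) - 1)"
    unfolding C_def using finP card_image_le[OF finP] cardP by auto
  ultimately show ?thesis by blast
qed

text \<open>
  The grid cover has at most \<open>m\<^sup>k\<^sup>-\<^sup>1\<close> cells of diameter \<open>R / m\<close>, and the resulting upper bound
  \<open>R\<^sup>s m\<^sup>k\<^sup>-\<^sup>1\<^sup>-\<^sup>s\<close> tends to zero.
\<close>
lemma hausdorff_measure_hyperplane_null:
  fixes F :: "(real^'k) set"
  assumes F: "bounded F" "v \<noteq> 0" "\<And>x. x \<in> F \<Longrightarrow> v \<bullet> x = \<beta>"
    and s: "real CARD('k) - 1 < s"
  shows "hausdorff_measure s F = 0"
proof -
  obtain j where j: "v $ j \<noteq> 0"
    using F(2) by (auto simp: vec_eq_iff)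
  obtain B where B: "0 < B" "\<And>x. x \<in> F \<Longrightarrow> norm x < B"
    using F(1) unfolding bounded_pos_less by blast
  have Bi: "\<bar>x $ i\<bar> < B" if "x \<in> F" for x i
    using B(2)[OF that] component_le_norm_cart[of x i] by linarith
  define n where "n = CARD('k) - 1"
  have "1 \<le> CARD('k)"
    by (simp add: Suc_le_eq)
  then have "real n = real CARD('k) - 1"
    unfolding n_def by (simp add: of_nat_diff)
  then have n: "real n < s" "0 < s"
    using s by linarith+
  define R where "R = (\<Sum>i\<in>-{j}. 1 + \<bar>v $ i / v $ j\<bar>) * (2 * B)"
  have R: "0 \<le> R"
    unfolding R_def using B(1) by (intro mult_nonneg_nonneg sum_nonneg) auto
  have bound: "hausdorff_premeasure s \<delta> F \<le> ennreal (R powr s * real m powr (real n - s))"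
    if m: "0 < m" "R / real m \<le> \<delta>" for m \<delta>
  proof -
    obtain C where C: "finite C" "card C \<le> m ^ n" "F \<subseteq> \<Union>C"
      "\<And>U. U \<in> C \<Longrightarrow> bounded U \<and> diameter U \<le> R / real m"
      using hyperplane_grid_cover[of v j F \<beta> B m, OF j F(3) Bi B(1) m(1)]
      unfolding R_def n_def by auto
    have "hausdorff_premeasure s \<delta> F \<le> of_nat (card C) * ennreal ((R / real m) powr s)"
      using C n m R by (intro hausdorff_premeasure_finite_cover) auto
    also have "\<dots> \<le> of_nat (m ^ n) * ennreal ((R / real m) powr s)"
      using C(2) by (intro mult_right_mono of_nat_mono) auto
    also have "\<dots> = ennreal (real (m ^ n) * (R / real m) powr s)"
      by (subst ennreal_mult) (auto simp: ennreal_of_nat_eq_real_of_nat)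
    also have "real (m ^ n) * (R / real m) powr s = R powr s * real m powr (real n - s)"
      using m R by (simp add: powr_divide powr_diff powr_realpow)
    finally show ?thesis .
  qed
  have "hausdorff_premeasure s \<delta> F \<le> 0" if "0 < \<delta>" for \<delta>
  proof (rule tendsto_lowerbound)
    have "(\<lambda>m. real m powr (real n - s)) \<longlonglongrightarrow> 0"
      using n by (intro tendsto_neg_powr filterlim_real_sequentially) auto
    then have "(\<lambda>m. R powr s * real m powr (real n - s)) \<longlonglongrightarrow> 0"
      using tendsto_mult_left[of _ 0 sequentially "R powr s"] by simp
    then show "(\<lambda>m. ennreal (R powr s * real m powr (real n - s))) \<longlonglongrightarrow> 0"
      using tendsto_ennrealI by fastforce
    have "(\<lambda>m. R / real m) \<longlonglongrightarrow> 0"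
      by (rule lim_const_over_n)
    then have "\<forall>\<^sub>F m in sequentially. R / real m < \<delta>"
      using \<open>0 < \<delta>\<close> by (rule order_tendstoD)
    then show "\<forall>\<^sub>F m in sequentially.
        hausdorff_premeasure s \<delta> F \<le> ennreal (R powr s * real m powr (real n - s))"
      using eventually_gt_at_top[of 0]
    proof eventually_elim
      case (elim m)
      then show ?case
        using bound[of m \<delta>] by simp
    qed
  qed simp
  then have "hausdorff_measure s F \<le> 0"
    unfolding hausdorff_measure_def by (intro SUP_least) simp
  then show ?thesis
    by simp
qed

section \<open>The monoid of similarities of a set\<close>

text \<open>
  Continuity and injectivity follow from the scaling of distances.
\<close>
lemma sim_contraction_iff:
  "sim_contraction F f \<longleftrightarrow> f \<in> F \<rightarrow> F \<and>
     (\<exists>c. 0 < c \<and> c < 1 \<and> (\<forall>x\<in>F. \<forall>y\<in>F. dist (f x) (f y) = c * dist x y))"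
proof
  assume *: "f \<in> F \<rightarrow> F \<and>
     (\<exists>c. 0 < c \<and> c < 1 \<and> (\<forall>x\<in>F. \<forall>y\<in>F. dist (f x) (f y) = c * dist x y))"
  then obtain c where c: "0 < c" "c < 1" "\<And>x y. x \<in> F \<Longrightarrow> y \<in> F \<Longrightarrow> dist (f x) (f y) = c * dist x y"
    by blast
  have "c-lipschitz_on F f"
    using c by (intro lipschitz_onI) auto
  then have "continuous_on F f"
    by (rule lipschitz_on_continuous_on)
  moreover have "inj_on f F"
  proof (rule inj_onI)
    fix x y assume "x \<in> F" "y \<in> F" "f x = f y"
    then have "c * dist x y = 0"
      using c(3)[of x y] by simp
    then show "x = y"
      using c(1) by simp
  qed
  ultimately show "sim_contraction F f"
    using * unfolding sim_contraction_def by blast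
qed (simp add: sim_contraction_def)

lemma sim_monoid_simps [simp]:
  "mult (sim_monoid F) = compose F" "one (sim_monoid F) = (\<lambda>x\<in>F. x)"
  by (simp_all add: sim_monoid_def)

lemma sim_monoidD:
  assumes "f \<in> carrier (sim_monoid F)"
  shows "f \<in> extensional F" "f \<in> F \<rightarrow> F"
    "\<exists>c. 0 < c \<and> c \<le> 1 \<and> (\<forall>x\<in>F. \<forall>y\<in>F. dist (f x) (f y) = c * dist x y)"
proof -
  show "f \<in> extensional F"
    using assms by (simp add: sim_monoid_def)
  consider "sim_contraction F f" | "self_isometry F f"
    using assms by (auto simp: sim_monoid_def)
  then have "f \<in> F \<rightarrow> F \<and>
      (\<exists>c. 0 < c \<and> c \<le> 1 \<and> (\<forall>x\<in>F. \<forall>y\<in>F. dist (f x) (f y) = c * dist x y))"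
  proof cases
    case 1
    then show ?thesis
      unfolding sim_contraction_def by (meson less_imp_le)
  next
    case 2
    then show ?thesis
      by (auto simp: self_isometry_def bij_betw_def intro!: exI[of _ 1])
  qed
  then show "f \<in> F \<rightarrow> F"
    "\<exists>c. 0 < c \<and> c \<le> 1 \<and> (\<forall>x\<in>F. \<forall>y\<in>F. dist (f x) (f y) = c * dist x y)"
    by blast+
qed

lemma inj_on_sim_monoid:
  assumes "f \<in> carrier (sim_monoid F)"
  shows "inj_on f F"
  using assms by (auto simp: sim_monoid_def sim_contraction_def self_isometry_def bij_betw_def)

lemma compose_in_sim_monoid:
  assumes f: "f \<in> carrier (sim_monoid F)" and g: "g \<in> carrier (sim_monoid F)"
  shows "compose F f g \<in> carrier (sim_monoid F)"
proof -
  have FF: "compose F f g \<in> F \<rightarrow> F"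
    using sim_monoidD(2)[OF f] sim_monoidD(2)[OF g] by (auto simp: compose_def)
  have dist_compose: "dist (compose F f g x) (compose F f g y) = a * b * dist x y"
    if "x \<in> F" "y \<in> F" "\<forall>x\<in>F. \<forall>y\<in>F. dist (f x) (f y) = a * dist x y"
      "\<forall>x\<in>F. \<forall>y\<in>F. dist (g x) (g y) = b * dist x y" for x y a b
    using that sim_monoidD(2)[OF g] by (simp add: compose_def Pi_iff)
  obtain a where a: "0 < a" "a \<le> 1" "\<forall>x\<in>F. \<forall>y\<in>F. dist (f x) (f y) = a * dist x y"
    using sim_monoidD(3)[OF f] by blast
  obtain b where b: "0 < b" "b \<le> 1" "\<forall>x\<in>F. \<forall>y\<in>F. dist (g x) (g y) = b * dist x y"
    using sim_monoidD(3)[OF g] by blast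
  have "sim_contraction F (compose F f g) \<or> self_isometry F (compose F f g)"
  proof (cases "sim_contraction F f \<or> sim_contraction F g")
    case True
    have "\<exists>c. 0 < c \<and> c < 1 \<and>
        (\<forall>x\<in>F. \<forall>y\<in>F. dist (compose F f g x) (compose F f g y) = c * dist x y)"
      using True
    proof
      assume "sim_contraction F f"
      then obtain a' where a': "0 < a'" "a' < 1" "\<forall>x\<in>F. \<forall>y\<in>F. dist (f x) (f y) = a' * dist x y"
        unfolding sim_contraction_def by blast
      have "a' * b < 1"
        using a' b mult_left_le[of b a'] by linarith
      then show ?thesis
        using a' b dist_compose[OF _ _ a'(3) b(3)] by (intro exI[of _ "a' * b"]) simp
    next
      assume "sim_contraction F g"
      then obtain b' where b': "0 < b'" "b' < 1" "\<forall>x\<in>F. \<forall>y\<in>F. dist (g x) (g y) = b' * dist x y"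
        unfolding sim_contraction_def by blast
      have "a * b' < 1"
        using a b' mult_left_le_one_le[of b' a] by linarith
      then show ?thesis
        using a b' dist_compose[OF _ _ a(3) b'(3)] by (intro exI[of _ "a * b'"]) simp
    qed
    then show ?thesis
      using FF by (simp add: sim_contraction_iff)
  next
    case False
    then have iso: "self_isometry F f" "self_isometry F g"
      using f g by (auto simp: sim_monoid_def)
    then have "bij_betw (compose F f g) F F"
      unfolding self_isometry_def by (blast intro: bij_betw_compose)
    moreover have "\<forall>x\<in>F. \<forall>y\<in>F. dist (compose F f g x) (compose F f g y) = dist x y"
      using dist_compose[of _ _ 1 1] iso by (simp add: self_isometry_def)
    ultimately show ?thesis
      by (simp add: self_isometry_def)
  qed
  then show ?thesis
    by (simp add: sim_monoid_def)
qed

lemma monoid_sim_monoid: "monoid (sim_monoid F)"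
proof (rule monoidI)
  show "one (sim_monoid F) \<in> carrier (sim_monoid F)"
    by (auto simp: sim_monoid_def self_isometry_def bij_betw_def inj_on_def)
qed (auto simp: compose_in_sim_monoid compose_assoc[OF sim_monoidD(2)] sim_monoidD(1,2) Id_compose[OF sim_monoidD(2,1)] compose_Id[OF sim_monoidD(2,1)])

lemma image_compose_self: "compose A g f ` A = g ` (f ` A)"
  by (auto simp: compose_def)

lemma isometries_iff:
  "g \<in> isometries F \<longleftrightarrow> g \<in> extensional F \<and> g ` F = F \<and> (\<forall>x\<in>F. \<forall>y\<in>F. dist (g x) (g y) = dist x y)"
proof -
  have "inj_on g F" if "\<forall>x\<in>F. \<forall>y\<in>F. dist (g x) (g y) = dist x y"
  proof (rule inj_onI)
    fix x y assume "x \<in> F" "y \<in> F" "g x = g y"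
    then have "dist x y = 0"
      using that by (metis dist_self)
    then show "x = y" by simp
  qed
  then show ?thesis
    unfolding isometries_def self_isometry_def bij_betw_def by blast
qed

lemma isometries_subset_sim_monoid: "isometries F \<subseteq> carrier (sim_monoid F)"
  by (auto simp: isometries_def sim_monoid_def)

lemma isometries_subset_Units: "isometries F \<subseteq> Units (sim_monoid F)"
proof
  fix g assume g: "g \<in> isometries F"
  then have gb: "bij_betw g F F" "g \<in> extensional F" and gd: "\<forall>x\<in>F. \<forall>y\<in>F. dist (g x) (g y) = dist x y"
    by (simp_all add: isometries_def self_isometry_def)
  define h where "h = restrict (inv_into F g) F"
  have inv: "h x \<in> F" "g (h x) = x" "h (g x) = x" if "x \<in> F" for x
    unfolding h_def using gb(1) that
    by (auto simp: bij_betw_def inv_into_into f_inv_into_f)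
  have "h ` F = F"
    using gb(1) by (simp add: h_def bij_betw_inv_into bij_betw_imp_surj_on)
  moreover have "\<forall>x\<in>F. \<forall>y\<in>F. dist (h x) (h y) = dist x y"
    using gd inv by metis
  ultimately have "h \<in> isometries F"
    by (simp add: isometries_iff h_def)
  moreover have "compose F h g = (\<lambda>x\<in>F. x)" "compose F g h = (\<lambda>x\<in>F. x)"
    using inv by (auto simp: compose_def intro!: restrict_ext)
  ultimately show "g \<in> Units (sim_monoid F)"
    using g isometries_subset_sim_monoid[of F] by (auto simp: Units_def)
qed

text \<open>
  A similarity multiplies the diameter of \<open>F\<close> by its ratio; if its image is \<open>F\<close> again, the ratio
  is one because the diameter is positive and attained.
\<close>
lemma compact_similarity_onto_isometry:
  assumes "compact F" "p \<in> F" "q \<in> F" "p \<noteq> q" "h ` F = F"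
    and h: "\<And>x y. x \<in> F \<Longrightarrow> y \<in> F \<Longrightarrow> dist (h x) (h y) = c * dist x y"
  shows "c = 1"
proof -
  have bdd: "bounded F"
    using assms(1) by (rule compact_imp_bounded)
  have pos: "0 < diameter F"
    using diameter_bounded_bound[OF bdd \<open>p \<in> F\<close> \<open>q \<in> F\<close>] zero_less_dist_iff[of p q] \<open>p \<noteq> q\<close>
    by linarith
  obtain x y where xy: "x \<in> F" "y \<in> F" "dist x y = diameter F"
    using diameter_compact_attained[OF assms(1)] assms(2) by blast
  have "c * diameter F = dist (h x) (h y)"
    using h[OF xy(1,2)] xy(3) by simp
  also have "\<dots> \<le> diameter F"
    using assms(5) xy by (intro diameter_bounded_bound[OF bdd]) auto
  finally have "c \<le> 1"
    using pos by simp
  have "0 \<le> c"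
    using h[OF assms(2,3)] \<open>p \<noteq> q\<close> zero_le_dist[of "h p" "h q"] by (simp add: zero_le_mult_iff)
  obtain x' y' where x': "x' \<in> F" "y' \<in> F" "x = h x'" "y = h y'"
    using xy assms(5) by (metis imageE)
  have "diameter F = c * dist x' y'"
    using h[OF x'(1,2)] x' xy(3) by simp
  also have "\<dots> \<le> c * diameter F"
    using \<open>0 \<le> c\<close> diameter_bounded_bound[OF bdd x'(1,2)] by (rule mult_left_mono[rotated])
  finally have "1 \<le> c"
    using pos by simp
  with \<open>c \<le> 1\<close> show "c = 1" by simp
qed

text \<open>
  The map \<open>h\<close> is the inverse of \<open>t\<close> applied after \<open>s\<close>. It is a similarity of \<open>F\<close> onto itself, hence
  an isometry. This turns equalities of images into equalities up to isometries on the right.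
\<close>
lemma sim_monoid_same_image:
  assumes F: "compact F" "p \<in> F" "q \<in> F" "p \<noteq> q"
    and s: "s \<in> carrier (sim_monoid F)" and t: "t \<in> carrier (sim_monoid F)"
    and im: "s ` F = t ` F"
  shows "\<exists>h\<in>isometries F. s = compose F t h"
proof -
  define h where "h = restrict (\<lambda>x. inv_into F t (s x)) F"
  have th: "h x \<in> F" "t (h x) = s x" if "x \<in> F" for x
  proof -
    have "s x \<in> t ` F" using that im by blast
    then show "h x \<in> F" "t (h x) = s x"
      using that by (auto simp: h_def inv_into_into f_inv_into_f)
  qed
  have "y \<in> h ` F" if y: "y \<in> F" for y
  proof -
    obtain x where x: "x \<in> F" "t y = s x" using y im by blast
    then have "t (h x) = t y" using th by simp
    then have "h x = y"
      using inj_on_sim_monoid[OF t] th(1)[OF x(1)] y by (simp add: inj_on_eq_iff)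
    then show ?thesis using x by blast
  qed
  then have hF: "h ` F = F"
    using th by blast
  obtain a where a: "0 < a" "\<forall>x\<in>F. \<forall>y\<in>F. dist (s x) (s y) = a * dist x y"
    using sim_monoidD(3)[OF s] by blast
  obtain b where b: "0 < b" "\<forall>x\<in>F. \<forall>y\<in>F. dist (t x) (t y) = b * dist x y"
    using sim_monoidD(3)[OF t] by blast
  have hd: "dist (h x) (h y) = (a / b) * dist x y" if "x \<in> F" "y \<in> F" for x y
  proof -
    have "b * dist (h x) (h y) = a * dist x y"
      using a b th that by metis
    then show ?thesis
      using b(1) by (simp add: field_simps)
  qed
  have "a / b = 1"
    by (rule compact_similarity_onto_isometry[OF F hF hd])
  then have "h \<in> isometries F"
    using hd hF by (simp add: isometries_iff h_def)
  moreover have "s = compose F t h"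
    using th sim_monoidD(1)[OF s] by (intro extensionalityI[of s F]) (auto simp: compose_def)
  ultimately show ?thesis by blast
qed

text \<open>
  Ratios multiply and are at most one, so an invertible element has ratio one; two distinct points
  are enough to read off the ratio.
\<close>
lemma Units_sim_monoid:
  assumes F: "p \<in> F" "q \<in> F" "p \<noteq> q"
  shows "Units (sim_monoid F) = isometries F"
proof
  show "Units (sim_monoid F) \<subseteq> isometries F"
  proof
    fix g assume "g \<in> Units (sim_monoid F)"
    then obtain h where g: "g \<in> carrier (sim_monoid F)" and h: "h \<in> carrier (sim_monoid F)"
      and gh: "compose F h g = (\<lambda>x\<in>F. x)"
      by (auto simp: Units_def)
    obtain a where a: "0 < a" "a \<le> 1" "\<forall>x\<in>F. \<forall>y\<in>F. dist (h x) (h y) = a * dist x y"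
      using sim_monoidD(3)[OF h] by blast
    have hg: "h (g x) = x" "g x \<in> F" if "x \<in> F" for x
      using fun_cong[OF gh, of x] sim_monoidD(2)[OF g] that by (auto simp: compose_def)
    have "\<not> sim_contraction F g"
    proof
      assume "sim_contraction F g"
      then obtain c where c: "c < 1" "\<forall>x\<in>F. \<forall>y\<in>F. dist (g x) (g y) = c * dist x y"
        unfolding sim_contraction_def by blast
      have "dist p q = dist (h (g p)) (h (g q))"
        using hg F by simp
      also have "\<dots> = a * dist (g p) (g q)"
        using a(3) hg(2)[OF F(1)] hg(2)[OF F(2)] by blast
      also have "\<dots> = a * (c * dist p q)"
        using c F by simp
      also have "\<dots> \<le> 1 * (c * dist p q)"
        using a c F by (intro mult_right_mono) (auto simp flip: c(2))
      also have "\<dots> < dist p q"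
        using c F by simp
      finally show False by simp
    qed
    then show "g \<in> isometries F"
      using g by (auto simp: sim_monoid_def isometries_def)
  qed
qed (rule isometries_subset_Units)

text \<open>
  The inverse of a similarity is Lipschitz, so a null image would make \<open>F\<close> a null set.
\<close>
lemma hausdorff_measure_sim_image_pos:
  fixes F :: "(real^'k) set"
  assumes dim: "real CARD('k) - 1 < d" and pos: "0 < hausdorff_measure d F"
    and s: "s \<in> carrier (sim_monoid F)"
  shows "0 < hausdorff_measure d (s ` F)"
proof (rule ccontr)
  have "0 < CARD('k)"
    by simp
  then have d: "0 < d"
    using dim by linarith
  assume "\<not> 0 < hausdorff_measure d (s ` F)"
  then have 0: "hausdorff_measure d (s ` F) = 0" by simp
  obtain c where c: "0 < c" "\<forall>x\<in>F. \<forall>y\<in>F. dist (s x) (s y) = c * dist x y"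
    using sim_monoidD(3)[OF s] by blast
  have inj: "inj_on s F"
    by (rule inj_on_sim_monoid[OF s])
  have "hausdorff_measure d (inv_into F s ` (s ` F)) \<le> ennreal ((1 / c) powr d) * hausdorff_measure d (s ` F)"
  proof (rule hausdorff_measure_lipschitz_image[OF d])
    fix u v assume "u \<in> s ` F" "v \<in> s ` F"
    then obtain x y where "x \<in> F" "y \<in> F" "u = s x" "v = s y" by blast
    then show "dist (inv_into F s u) (inv_into F s v) \<le> 1 / c * dist u v"
      using c inj by (simp add: inv_into_f_f)
  qed (use c in simp)
  moreover have "inv_into F s ` (s ` F) = F"
    using inj by (simp add: inv_into_image_cancel)
  ultimately show False
    using 0 pos by simp
qed

lemma bisecting_hyperplane:
  fixes a b p :: "'a::real_inner"
  assumes "dist a p = dist b p"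
  shows "(b - a) \<bullet> p = (b \<bullet> b - a \<bullet> a) / 2"
proof -
  have "(a - p) \<bullet> (a - p) = (b - p) \<bullet> (b - p)"
    using assms by (simp add: dist_norm flip: power2_norm_eq_inner)
  then show ?thesis
    by (simp add: inner_diff inner_commute field_simps)
qed

text \<open>
  The maps \<open>a\<close> and \<open>b\<close> have the same ratio, because they agree at the distinct points \<open>s p\<close> and
  \<open>s q\<close>. Hence \<open>a x\<close> and \<open>b x\<close> have equal distances to each point of \<open>a (s F)\<close>. If they were
  different, that set would lie in their bisecting hyperplane and be null, which a similar copy of
  \<open>F\<close> is not.
\<close>
lemma sim_monoid_r_cancel:
  fixes F :: "(real^'k) set"
  assumes F: "compact F" "real CARD('k) - 1 < d" "0 < hausdorff_measure d F"
    and s: "s \<in> carrier (sim_monoid F)" and a: "a \<in> carrier (sim_monoid F)"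
    and b: "b \<in> carrier (sim_monoid F)" and eq: "compose F a s = compose F b s"
    and two: "p \<in> F" "q \<in> F" "p \<noteq> q"
  shows "a = b"
proof (rule extensionalityI[OF sim_monoidD(1)[OF a] sim_monoidD(1)[OF b]])
  fix x assume x: "x \<in> F"
  have ab: "a (s y) = b (s y)" "s y \<in> F" if "y \<in> F" for y
    using fun_cong[OF eq, of y] sim_monoidD(2)[OF s] that by (auto simp: compose_def)
  obtain c where c: "0 < c" "\<forall>x\<in>F. \<forall>y\<in>F. dist (a x) (a y) = c * dist x y"
    using sim_monoidD(3)[OF a] by blast
  obtain c' where c': "0 < c'" "\<forall>x\<in>F. \<forall>y\<in>F. dist (b x) (b y) = c' * dist x y"
    using sim_monoidD(3)[OF b] by blast
  have "s p \<noteq> s q"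
    using inj_on_sim_monoid[OF s] two by (simp add: inj_on_eq_iff)
  moreover have "c * dist (s p) (s q) = c' * dist (s p) (s q)"
    using c(2) c'(2) ab two by metis
  ultimately have cc: "c = c'" by simp
  show "a x = b x"
  proof (rule ccontr)
    assume ne: "a x \<noteq> b x"
    let ?A = "compose F a s ` F"
    have plane: "(b x - a x) \<bullet> z = (b x \<bullet> b x - a x \<bullet> a x) / 2" if z: "z \<in> ?A" for z
    proof (rule bisecting_hyperplane)
      obtain y where y: "y \<in> F" "z = a (s y)"
        using z by (auto simp: compose_def)
      have "dist (a x) (a (s y)) = c * dist x (s y)" "dist (b x) (b (s y)) = c' * dist x (s y)"
        using c(2) c'(2) ab(2)[OF y(1)] x by blast+
      then have "dist (a x) (a (s y)) = dist (b x) (b (s y))"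
        using cc by simp
      then show "dist (a x) z = dist (b x) z"
        using ab y by simp
    qed
    have "?A \<subseteq> F"
      using sim_monoidD(2)[OF compose_in_sim_monoid[OF a s]] by blast
    then have bdd: "bounded ?A"
      using compact_imp_bounded[OF F(1)] bounded_subset by blast
    have "hausdorff_measure d ?A = 0"
      by (rule hausdorff_measure_hyperplane_null[OF bdd _ plane F(2)]) (use ne in auto)
    moreover have "0 < hausdorff_measure d ?A"
      by (rule hausdorff_measure_sim_image_pos[OF F(2,3) compose_in_sim_monoid[OF a s]])
    ultimately show False by simp
  qed
qed

text \<open>
  A single point lies in a hyperplane.
\<close>
lemma two_points_if_hausdorff_pos:
  fixes F :: "(real^'k) set"
  assumes "real CARD('k) - 1 < d" "0 < hausdorff_measure d F" "F \<noteq> {}"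
  obtains p q where "p \<in> F" "q \<in> F" "p \<noteq> q"
proof -
  obtain p where p: "p \<in> F" using assms(3) by blast
  have "\<exists>q\<in>F. q \<noteq> p"
  proof (rule ccontr)
    assume "\<not> (\<exists>q\<in>F. q \<noteq> p)"
    then have "F = {p}" using p by blast
    then have "hausdorff_measure d F = 0"
      using assms(1)
      by (intro hausdorff_measure_hyperplane_null[of _ "axis undefined 1" "axis undefined 1 \<bullet> p"])
        (auto simp: axis_eq_0_iff)
    then show False using assms(2) by simp
  qed
  then show ?thesis using that p by blast
qed

section \<open>Words in the pieces of a self-similar set\<close>

lemma word_prod_contracts:
  assumes X: "X \<subseteq> carrier (sim_monoid F)" and c: "0 \<le> c"
    and lip: "\<And>x p q. x \<in> X \<Longrightarrow> p \<in> F \<Longrightarrow> q \<in> F \<Longrightarrow> dist (x p) (x q) \<le> c * dist p q"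
    and w: "set w \<subseteq> X" and pq: "p \<in> F" "q \<in> F"
  shows "word_prod (sim_monoid F) w p \<in> F \<and>
    dist (word_prod (sim_monoid F) w p) (word_prod (sim_monoid F) w q) \<le> c ^ length w * dist p q"
  using w pq
proof (induction w arbitrary: p q)
  case Nil
  then show ?case by (simp add: word_prod_def)
next
  case (Cons x w)
  let ?w = "word_prod (sim_monoid F) w"
  have x: "x \<in> X" "set w \<subseteq> X"
    using Cons.prems by auto
  have wF: "?w p \<in> F" "?w q \<in> F"
    using Cons.IH[OF x(2)] Cons.prems(2,3) by blast+
  have "dist (x (?w p)) (x (?w q)) \<le> c * dist (?w p) (?w q)"
    by (rule lip[OF x(1) wF])
  also have "\<dots> \<le> c * (c ^ length w * dist p q)"
    using Cons.IH[OF x(2) Cons.prems(2,3)] c by (intro mult_left_mono) auto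
  finally have "dist (x (?w p)) (x (?w q)) \<le> c ^ length (x # w) * dist p q"
    by simp
  moreover have "x (?w p) \<in> F"
    using sim_monoidD(2)[of x F] X x wF by blast
  ultimately show ?case
    using Cons.prems(2,3) by (simp add: word_prod_def compose_def)
qed

lemma point_in_word_image:
  assumes F: "F = (\<Union>x\<in>X. x ` F)" and p: "p \<in> F"
  shows "\<exists>w. set w \<subseteq> X \<and> length w = n \<and> p \<in> word_prod (sim_monoid F) w ` F"
  using p
proof (induction n arbitrary: p)
  case 0
  then show ?case by (intro exI[of _ "[]"]) (simp add: word_prod_def)
next
  case (Suc n)
  then obtain x q where x: "x \<in> X" "q \<in> F" "p = x q"
    using equalityD1[OF F] by blast
  obtain w r where w: "set w \<subseteq> X" "length w = n" "r \<in> F" "q = word_prod (sim_monoid F) w r"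
    using Suc.IH[OF x(2)] by blast
  have "p = word_prod (sim_monoid F) (x # w) r"
    unfolding x(3) w(4) using w(3) by (simp add: word_prod_def compose_def)
  then have "p \<in> word_prod (sim_monoid F) (x # w) ` F"
    using w(3) by (rule image_eqI)
  moreover have "set (x # w) \<subseteq> X" "length (x # w) = Suc n"
    using x(1) w(1,2) by simp_all
  ultimately show ?case
    by blast
qed

text \<open>
  The condition on \<open>g\<close> says that it maps each piece \<open>w(F)\<close> into itself. A point \<open>p\<close> lies in pieces of
  words of every length \<open>n\<close>, whose diameters are at most \<open>c\<^sup>n diam(F)\<close>, so \<open>g p\<close> is arbitrarily close
  to \<open>p\<close>.
\<close>
lemma fixes_pieces_imp_identity:
  fixes F :: "'a::metric_space set"
  assumes F: "bounded F" "F = (\<Union>x\<in>X. x ` F)" and X: "X \<subseteq> carrier (sim_monoid F)"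
    and c: "0 \<le> c" "c < 1"
      "\<And>x p q. x \<in> X \<Longrightarrow> p \<in> F \<Longrightarrow> q \<in> F \<Longrightarrow> dist (x p) (x q) \<le> c * dist p q"
    and g: "\<And>w. set w \<subseteq> X \<Longrightarrow> \<exists>h\<in>F \<rightarrow> F.
      \<forall>x\<in>F. g (word_prod (sim_monoid F) w x) = word_prod (sim_monoid F) w (h x)"
    and p: "p \<in> F"
  shows "g p = p"
proof -
  have "dist (g p) p \<le> c ^ n * diameter F" for n
  proof -
    obtain w r where w: "set w \<subseteq> X" "length w = n" "r \<in> F" "p = word_prod (sim_monoid F) w r"
      using point_in_word_image[OF F(2) p, of n] by blast
    obtain h where h: "h \<in> F \<rightarrow> F" "g p = word_prod (sim_monoid F) w (h r)"
      using g[OF w(1)] w(3,4) by blast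
    have hr: "h r \<in> F" using h(1) w(3) by blast
    have "dist (g p) p \<le> c ^ n * dist (h r) r"
      using word_prod_contracts[OF X c(1,3) w(1) hr w(3)] w h by simp
    also have "\<dots> \<le> c ^ n * diameter F"
      using c(1) diameter_bounded_bound[OF F(1) hr w(3)] by (intro mult_left_mono) auto
    finally show ?thesis .
  qed
  moreover have "(\<lambda>n. c ^ n * diameter F) \<longlonglongrightarrow> 0"
    using c by (intro tendsto_mult_left_zero LIMSEQ_power_zero) auto
  ultimately have "dist (g p) p \<le> 0"
    by (intro LIMSEQ_le_const[of "\<lambda>n. c ^ n * diameter F"]) auto
  then show ?thesis by simp
qed

lemma uniform_contraction_ratio:
  assumes "finite X" "\<And>x. x \<in> X \<Longrightarrow> sim_contraction F x"
  shows "\<exists>c. 0 \<le> c \<and> c < 1 \<and> (\<forall>x\<in>X. \<forall>p\<in>F. \<forall>q\<in>F. dist (x p) (x q) \<le> c * dist p q)"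
  using assms
proof (induction X)
  case empty
  then show ?case by (intro exI[of _ 0]) simp
next
  case (insert x X)
  then obtain c where c: "0 \<le> c" "c < 1" "\<And>x p q. x \<in> X \<Longrightarrow> p \<in> F \<Longrightarrow> q \<in> F \<Longrightarrow> dist (x p) (x q) \<le> c * dist p q"
    by (metis insertCI)
  obtain a where a: "0 < a" "a < 1" "\<And>p q. p \<in> F \<Longrightarrow> q \<in> F \<Longrightarrow> dist (x p) (x q) = a * dist p q"
    using insert.prems[of x] unfolding sim_contraction_def by blast
  have "dist (y p) (y q) \<le> max a c * dist p q" if "y \<in> insert x X" "p \<in> F" "q \<in> F" for y p q
  proof (cases "y = x")
    case True
    then show ?thesis
      using a(3)[OF that(2,3)] mult_right_mono[of a "max a c" "dist p q"] by simp
  next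
    case False
    then have "dist (y p) (y q) \<le> c * dist p q"
      using c(3) that by blast
    also have "\<dots> \<le> max a c * dist p q"
      by (intro mult_right_mono) auto
    finally show ?thesis .
  qed
  then show ?case
    using a c by (intro exI[of _ "max a c"]) simp
qed

text \<open>
  Independence is where the null overlaps enter: \<open>x a = y b\<close> would force the image of \<open>x a\<close>, a
  similar copy of \<open>F\<close>, into \<open>x(F) \<inter> y(F)\<close>.
\<close>
lemma pieces_rigid_generators:
  fixes F :: "(real^'k) set"
  assumes F: "compact F" "F \<noteq> {}" "real CARD('k) - 1 < d" "0 < hausdorff_measure d F"
    and X: "\<And>x. x \<in> X \<Longrightarrow> sim_contraction F x" "X \<subseteq> extensional F"
    and null: "\<And>x y. x \<in> X \<Longrightarrow> y \<in> X \<Longrightarrow> x \<noteq> y \<Longrightarrow> hausdorff_measure d (x ` F \<inter> y ` F) = 0"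
    and permuted: "\<And>g x. g \<in> isometries F \<Longrightarrow> x \<in> X \<Longrightarrow> \<exists>y\<in>X. g ` (x ` F) = y ` F"
  shows "rigid_generators (sim_monoid F) X"
proof -
  obtain p q where pq: "p \<in> F" "q \<in> F" "p \<noteq> q"
    by (rule two_points_if_hausdorff_pos[OF F(3,4,2)])
  note Units = Units_sim_monoid[OF pq]
  have X_carrier: "X \<subseteq> carrier (sim_monoid F)"
    using X by (auto simp: sim_monoid_def)
  show ?thesis
  proof (intro rigid_generators.intro rigid_generators_axioms.intro)
    show "monoid (sim_monoid F)"
      by (rule monoid_sim_monoid)
  next
    fix a b c
    assume abc: "a \<in> carrier (sim_monoid F)" "b \<in> carrier (sim_monoid F)" "c \<in> carrier (sim_monoid F)"
    show "b = c" if eq: "a \<otimes>\<^bsub>sim_monoid F\<^esub> b = a \<otimes>\<^bsub>sim_monoid F\<^esub> c"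
    proof (rule extensionalityI[OF sim_monoidD(1)[OF abc(2)] sim_monoidD(1)[OF abc(3)]])
      fix x assume x: "x \<in> F"
      have bc: "b x \<in> F" "c x \<in> F"
        using sim_monoidD(2)[OF abc(2)] sim_monoidD(2)[OF abc(3)] x by blast+
      have "a (b x) = a (c x)"
        using fun_cong[OF eq, of x] x by (simp add: compose_def)
      then show "b x = c x"
        using inj_onD[OF inj_on_sim_monoid[OF abc(1)]] bc by blast
    qed
    show "b = c" if eq: "b \<otimes>\<^bsub>sim_monoid F\<^esub> a = c \<otimes>\<^bsub>sim_monoid F\<^esub> a"
      by (rule sim_monoid_r_cancel[OF F(1,3,4) abc _ pq]) (use eq in simp)
  next
    show "X \<subseteq> carrier (sim_monoid F)"
      by (rule X_carrier)
  next
    show "X \<inter> Units (sim_monoid F) = {}"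
    proof (rule equals0I)
      fix x assume "x \<in> X \<inter> Units (sim_monoid F)"
      then have "sim_contraction F x" and iso: "x \<in> isometries F"
        using X(1) Units by blast+
      then obtain c where "c < 1" "\<forall>u\<in>F. \<forall>v\<in>F. dist (x u) (x v) = c * dist u v"
        unfolding sim_contraction_def by blast
      moreover have "dist (x p) (x q) = dist p q"
        using iso pq unfolding isometries_iff by blast
      ultimately show False
        using pq by simp
    qed
  next
    fix x y a b
    assume xy: "x \<in> X" "y \<in> X" and ab: "a \<in> carrier (sim_monoid F)" "b \<in> carrier (sim_monoid F)"
      and eq: "x \<otimes>\<^bsub>sim_monoid F\<^esub> a = y \<otimes>\<^bsub>sim_monoid F\<^esub> b"
    show "x = y"
    proof (rule ccontr)
      assume "x \<noteq> y"
      have eq': "compose F x a = compose F y b"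
        using eq by simp
      have aF: "a ` F \<subseteq> F" "b ` F \<subseteq> F"
        using sim_monoidD(2)[OF ab(1)] sim_monoidD(2)[OF ab(2)] by blast+
      have "compose F x a ` F \<subseteq> x ` F"
        unfolding image_compose_self by (rule image_mono[OF aF(1)])
      moreover have "compose F x a ` F \<subseteq> y ` F"
        unfolding eq' image_compose_self by (rule image_mono[OF aF(2)])
      ultimately have "hausdorff_measure d (compose F x a ` F) \<le> hausdorff_measure d (x ` F \<inter> y ` F)"
        by (intro hausdorff_measure_mono) simp
      then have "hausdorff_measure d (compose F x a ` F) = 0"
        using null[OF xy \<open>x \<noteq> y\<close>] by simp
      moreover have "compose F x a \<in> carrier (sim_monoid F)"
        using compose_in_sim_monoid X_carrier xy(1) ab(1) by blast
      ultimately show False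
        using hausdorff_measure_sim_image_pos[OF F(3,4), of "compose F x a"] by simp
    qed
  next
    fix g x assume "g \<in> Units (sim_monoid F)" and x: "x \<in> X"
    then have g: "g \<in> isometries F"
      using Units by simp
    obtain y where y: "y \<in> X" "g ` (x ` F) = y ` F"
      using permuted[OF g x] by blast
    have gx: "compose F g x \<in> carrier (sim_monoid F)"
      using compose_in_sim_monoid isometries_subset_sim_monoid g x X_carrier by blast
    have "compose F g x ` F = y ` F"
      using y(2) by (simp only: image_compose_self)
    then obtain h where "h \<in> isometries F" "compose F g x = compose F y h"
      using sim_monoid_same_image[OF F(1) pq gx] X_carrier y(1) by blast
    then show "\<exists>y\<in>X. \<exists>h\<in>Units (sim_monoid F). g \<otimes>\<^bsub>sim_monoid F\<^esub> x = y \<otimes>\<^bsub>sim_monoid F\<^esub> h"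
      using y(1) unfolding Units sim_monoid_simps by blast
  qed
qed

text \<open>
  A unit \<open>g\<close> with \<open>g s \<in> s G\<close> for all \<open>s\<close> preserves all pieces \<open>w(F)\<close>, so it is the identity.
\<close>
lemma fundamental_sim_monoid:
  fixes F :: "'a::metric_space set"
  assumes F: "compact F" "p \<in> F" "q \<in> F" "p \<noteq> q" "F = (\<Union>x\<in>X. x ` F)"
    and X: "finite X" "X \<subseteq> extensional F" "\<And>x. x \<in> X \<Longrightarrow> sim_contraction F x"
  shows "fundamental (sim_monoid F)"
proof -
  let ?S = "sim_monoid F"
  interpret monoid ?S
    by (rule monoid_sim_monoid)
  have Units: "Units ?S = isometries F"
    by (rule Units_sim_monoid[OF F(2-4)])
  have X_carrier: "X \<subseteq> carrier ?S"
    using X by (auto simp: sim_monoid_def)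
  have words: "word_prod ?S w \<in> carrier ?S" if "set w \<subseteq> X" for w
    using that
  proof (induction w)
    case Nil
    show ?case using one_closed by (simp only: word_prod_def foldr.simps id_apply)
  next
    case (Cons x w)
    then have "x \<in> carrier ?S" "word_prod ?S w \<in> carrier ?S"
      using X_carrier by auto
    then show ?case
      using m_closed unfolding word_prod_def by simp
  qed
  obtain c where c: "0 \<le> c" "c < 1"
    "\<And>x p q. x \<in> X \<Longrightarrow> p \<in> F \<Longrightarrow> q \<in> F \<Longrightarrow> dist (x p) (x q) \<le> c * dist p q"
    using uniform_contraction_ratio[OF X(1,3)] by blast
  have "g = \<one>\<^bsub>?S\<^esub>" if g: "g \<in> Units ?S" "\<forall>s\<in>carrier ?S. g \<otimes>\<^bsub>?S\<^esub> s \<in> s <#\<^bsub>?S\<^esub> Units ?S" for g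
  proof -
    have "\<exists>h\<in>F \<rightarrow> F. \<forall>x\<in>F. g (word_prod ?S w x) = word_prod ?S w (h x)" if w: "set w \<subseteq> X" for w
    proof -
      have "g \<otimes>\<^bsub>?S\<^esub> word_prod ?S w \<in> word_prod ?S w <#\<^bsub>?S\<^esub> isometries F"
        using g(2) words[OF w] unfolding Units by blast
      then obtain h where h: "h \<in> isometries F"
        "compose F g (word_prod ?S w) = compose F (word_prod ?S w) h"
        by (auto simp: l_coset_def)
      have "h \<in> F \<rightarrow> F"
        using h(1) by (auto simp: isometries_iff)
      moreover have "g (word_prod ?S w x) = word_prod ?S w (h x)" if "x \<in> F" for x
        using fun_cong[OF h(2), of x] that by (simp add: compose_def)
      ultimately show ?thesis by blast
    qed
    then have "g x = x" if "x \<in> F" for x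
      using fixes_pieces_imp_identity[OF compact_imp_bounded[OF F(1)] F(5) X_carrier c, of g x] that
      by blast
    moreover have "g \<in> extensional F"
      using g(1) unfolding Units by (simp add: isometries_iff)
    ultimately show "g = \<one>\<^bsub>?S\<^esub>"
      by (intro extensionalityI[of g F]) auto
  qed
  moreover have "\<one>\<^bsub>?S\<^esub> \<otimes>\<^bsub>?S\<^esub> s \<in> s <#\<^bsub>?S\<^esub> Units ?S" if s: "s \<in> carrier ?S" for s
  proof -
    have "\<one>\<^bsub>?S\<^esub> \<otimes>\<^bsub>?S\<^esub> s = s \<otimes>\<^bsub>?S\<^esub> \<one>\<^bsub>?S\<^esub>"
      using l_one[OF s] r_one[OF s] by (rule trans[OF _ sym])
    then show ?thesis
      unfolding l_coset_def using Units_one_closed by blast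
  qed
  ultimately show ?thesis
    unfolding fundamental_def using Units_one_closed by blast
qed

theorem theorem2p5p4:
  fixes D F :: "(real ^ 'k) set"
    and n :: nat
    and f :: "nat \<Rightarrow> real ^ 'k \<Rightarrow> real ^ 'k"
    and d :: real
    and I :: "nat set"
    and \<mu> :: "(real ^ 'k) set \<Rightarrow> ennreal"
    and MF M :: "(real ^ 'k \<Rightarrow> real ^ 'k) monoid"
    and G X Xstar :: "(real ^ 'k \<Rightarrow> real ^ 'k) set"
  assumes "I = {1..n}"
    and "\<mu> = hausdorff_measure d"
    and "MF = sim_monoid F"
    and "G = isometries F"
    and "X = (\<lambda>i. restrict (f i) F) ` I"
    and "Xstar = semigroup_span MF (X \<union> {\<one>\<^bsub>MF\<^esub>})"
    and "M = MF\<lparr>carrier := semigroup_span MF (X \<union> G)\<rparr>"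
    and "compact D" and "path_connected D"
    and "\<forall>i\<in>I. sim_contraction D (f i)"
    and "is_attractor D I f F"
    and "ereal d = hausdorff_dim F"
    and "d > real CARD('k) - 1"
    and "0 < \<mu> F" and "\<mu> F < \<infinity>"
    and i: "\<forall>i\<in>I. \<forall>j\<in>I. i \<noteq> j \<longrightarrow> \<mu> (f i ` F \<inter> f j ` F) = 0"
    and ii: "\<not> (\<exists>h. sim_contraction F h \<and> (\<exists>i\<in>I. f i ` F \<subset> h ` F))"
    and iii: "\<forall>i\<in>I. \<forall>g\<in>G. \<exists>j\<in>I. g ` (f i ` F) = f j ` F"
  shows "generates_free_semigroup MF X
    \<and> (carrier M = Xstar <#>\<^bsub>MF\<^esub> G
        \<and> (\<forall>m\<in>carrier M. \<exists>!(x, g). x \<in> Xstar \<and> g \<in> G \<and> m = x \<otimes>\<^bsub>MF\<^esub> g))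
    \<and> rees_monoid M
    \<and> ((\<forall>s\<in>carrier MF. \<exists>x\<in>Xstar. s ` F = x ` F)
        \<longrightarrow> M = MF \<and> rees_monoid M \<and> fundamental M)"
proof -
  note defs = assms(1-7)
  have F: "F \<noteq> {}" "compact F" "F \<subseteq> D" "F = (\<Union>i\<in>I. f i ` F)"
    using \<open>is_attractor D I f F\<close> by (auto simp: is_attractor_def)
  have pos: "0 < hausdorff_measure d F"
    using \<open>0 < \<mu> F\<close> unfolding \<open>\<mu> = hausdorff_measure d\<close> .
  obtain p q where pq: "p \<in> F" "q \<in> F" "p \<noteq> q"
    by (rule two_points_if_hausdorff_pos[OF \<open>d > real CARD('k) - 1\<close> pos F(1)])
  have UnitsG: "Units MF = G"
    using Units_sim_monoid[OF pq] defs(3,4) by simp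
  have X_contr: "sim_contraction F x" if x: "x \<in> X" for x
  proof -
    obtain i where i: "i \<in> I" "x = restrict (f i) F"
      using x defs(5) by blast
    obtain c where "0 < c" "c < 1" "\<forall>x\<in>D. \<forall>y\<in>D. dist (f i x) (f i y) = c * dist x y"
      using \<open>\<forall>i\<in>I. sim_contraction D (f i)\<close> i(1) unfolding sim_contraction_def by blast
    moreover have "f i y \<in> F" if "y \<in> F" for y
      using F(4) i(1) that by blast
    ultimately show ?thesis
      unfolding sim_contraction_iff i(2) using F(3) by (intro conjI exI[of _ c]) auto
  qed
  have X_ext: "X \<subseteq> extensional F"
    unfolding defs(5) by auto
  have X_image: "restrict (f i) F ` F = f i ` F" for i
    by auto
  have FX: "F = (\<Union>x\<in>X. x ` F)"
    using F(4) unfolding defs(5) by (simp add: X_image)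
  interpret rigid_generators MF X
    unfolding defs(3)
  proof (rule pieces_rigid_generators[OF F(2,1) \<open>d > real CARD('k) - 1\<close> pos X_contr X_ext])
    fix x y assume xy: "x \<in> X" "y \<in> X" "x \<noteq> y"
    obtain i j where "i \<in> I" "x = restrict (f i) F" "j \<in> I" "y = restrict (f j) F"
      using xy(1,2) unfolding defs(5) by blast
    then show "hausdorff_measure d (x ` F \<inter> y ` F) = 0"
      using i \<open>x \<noteq> y\<close> unfolding defs(2) by (auto simp: X_image)
  next
    fix g x assume g: "g \<in> isometries F" and x: "x \<in> X"
    obtain i where i: "i \<in> I" "x = restrict (f i) F"
      using x unfolding defs(5) by blast
    obtain j where j: "j \<in> I" "g ` (f i ` F) = f j ` F"
      using iii i(1) g unfolding defs(4) by blast
    have "restrict (f j) F \<in> X"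
      using j(1) unfolding defs(5) by blast
    moreover have "g ` (x ` F) = restrict (f j) F ` F"
      using j(2) unfolding i(2) X_image .
    ultimately show "\<exists>y\<in>X. g ` (x ` F) = y ` F"
      by blast
  qed
  have carrM: "carrier M = generated" and M: "M = MF\<lparr>carrier := generated\<rparr>"
    using semigroup_span_X_Units unfolding UnitsG defs(7) by simp_all
  have "X \<noteq> {}"
    using FX F(1) by blast
  then have rees: "rees_monoid M"
    unfolding M by (rule graded_rigid_monoid.rees[OF generated_graded_rigid])
  have "M = MF \<and> fundamental M" if all: "\<forall>s\<in>carrier MF. \<exists>x\<in>Xstar. s ` F = x ` F"
  proof
    have "s \<in> generated" if s: "s \<in> carrier MF" for s
    proof -
      obtain w where w: "set w \<subseteq> X" "s ` F = word w ` F"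
        using all s unfolding semigroup_span_X_one defs(6) by blast
      have "word w \<in> carrier MF" using w(1) by simp
      then obtain h where "h \<in> isometries F" "s = compose F (word w) h"
        using sim_monoid_same_image[OF F(2) pq _ _ w(2)] s unfolding defs(3) by blast
      then have "h \<in> Units MF" "s = word w \<otimes>\<^bsub>MF\<^esub> h"
        unfolding UnitsG defs(4) by (simp_all add: defs(3))
      then show ?thesis
        using generatedI[OF w(1)] by simp
    qed
    then have "generated = carrier MF"
      using generated_carrier by blast
    then show MMF: "M = MF"
      unfolding M by simp
    have "finite X"
      unfolding defs(1,5) by simp
    then show "fundamental M"
      unfolding MMF defs(3) using F(2) pq FX X_ext X_contr by (intro fundamental_sim_monoid)
  qed
  moreover have "carrier M = Xstar <#>\<^bsub>MF\<^esub> G"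
    "\<forall>m\<in>carrier M. \<exists>!(x, g). x \<in> Xstar \<and> g \<in> G \<and> m = x \<otimes>\<^bsub>MF\<^esub> g"
    using generated_factorisation unfolding carrM UnitsG defs(6) by blast+
  ultimately show ?thesis
    using free rees by blast
qed

end
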